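(* Let $S$ be a completely regular semigroup. The following conditions are equivalent. (1) $\ker\sigma$ is cryptic; (2) $\ker\sigma\subseteq\ker\mu$; (3) $\sigma\cap\mathcal{H}=\sigma\cap\mu$; (4) $\sigma\cap\mathcal{H}$ is a congruence on $S$; (5) $\pi\subseteq\mu$; (6) $\pi_t=\varepsilon$; (7) there exists an idempotent separating $E$-unitary congruence on $S$; (8) $\pi\cap\Theta=\varepsilon$; (9) $\pi$ is over groups.
   Context: A completely regular semigroup is a semigroup that is a union of its subgroups; for $a\in S$, $a^{-1}$ is the inverse of $a$ in the maximal subgroup containing $a$, and $a^0=aa^{-1}=a^{-1}a$. $E(S)$ is the set of idempotents of $S$, $\mathcal{H}$ is Green's relation, and $\varepsilon$ is the equality relation. A semigroup is cryptic if its Green's relation $\mathcal{H}$ is a congruence on it. A regular semigroup $T$ is $E$-unitary if $e\in E(T)$ and $ea\in E(T)$ (equivalently, $ae\in E(T)$) imply $a\in E(T)$. A congruence $\rho$ on $S$ is a $\mathcal{P}$-congruence (group congruence, $E$-unitary congruence, etc.) if $S/\rho$ has property $\mathcal{P}$. For a congruence $\rho$ on $S$: $\operatorname{tr}\rho=\rho|_{E(S)}$ and $\ker\rho=\{a\in S: a\,\rho\,e\text{ for some }e\in E(S)\}$; $\rho_t$ denotes the least congruence on $S$ with the same trace as $\rho$. $\sigma$ is the least group congruence on $S$ and $\pi$ is the least $E$-unitary congruence on $S$ ($\pi$ is also the least congruence on $S$ with the same kernel as $\sigma$). The set $\ker\sigma$ is a completely regular subsemigroup of $S$, and "$\ker\sigma$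 is cryptic" refers to Green's relation $\mathcal H$ of the semigroup $\ker\sigma$. A congruence is idempotent separating if any two idempotents related by it are equal; $\mu$ is the greatest idempotent separating congruence on $S$. The relation $\Theta$ on $S$ is defined by $a\,\Theta\,b\iff a^0b=ab^0$. A congruence is over groups if each of its classes that is a subsemigroup of $S$ is a group. *)

theory Defs
  imports "HOL-Algebra.Group"
begin

(* A semigroup is given by a carrier set and a binary operation, so that subsemigroups
   (such as ker sigma) and quotients S // rho are again semigroups of the same kind. *)

locale semigroup_on =
  fixes S :: "'a set" and m :: "'a \<Rightarrow> 'a \<Rightarrow> 'a"
  assumes nonempty: "S \<noteq> {}"
    and closed: "\<lbrakk>a \<in> S; b \<in> S\<rbrakk> \<Longrightarrow> m a b \<in> S"
    and assoc: "\<lbrakk>a \<in> S; b \<in> S; c \<in> S\<rbrakk> \<Longrightarrow> m (m a b) c = m a (m b c)"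

definition subsemigroup_of :: "'a set \<Rightarrow> ('a \<Rightarrow> 'a \<Rightarrow> 'a) \<Rightarrow> 'a set \<Rightarrow> bool" where
  "subsemigroup_of S m T \<longleftrightarrow> T \<subseteq> S \<and> semigroup_on T m"

(* The HOL-Algebra record on (G, m). A two-sided identity of (G, m) is unique if there is
   one; if there is none, the record is not a group whatever its unit is. *)
definition monoid_record :: "'a set \<Rightarrow> ('a \<Rightarrow> 'a \<Rightarrow> 'a) \<Rightarrow> 'a monoid" where
  "monoid_record G m =
     \<lparr>carrier = G, monoid.mult = m, one = (THE e. e \<in> G \<and> (\<forall>x\<in>G. m e x = x \<and> m x e = x))\<rparr>"

definition group_on :: "'a set \<Rightarrow> ('a \<Rightarrow> 'a \<Rightarrow> 'a) \<Rightarrow> bool" where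
  "group_on G m \<longleftrightarrow> group (monoid_record G m)"

definition subgroup_of :: "'a set \<Rightarrow> ('a \<Rightarrow> 'a \<Rightarrow> 'a) \<Rightarrow> 'a set \<Rightarrow> bool" where
  "subgroup_of S m G \<longleftrightarrow> G \<subseteq> S \<and> group_on G m"

locale completely_regular_semigroup = semigroup_on +
  assumes union_of_subgroups: "S = \<Union>{G. subgroup_of S m G}"

definition maximal_subgroup :: "'a set \<Rightarrow> ('a \<Rightarrow> 'a \<Rightarrow> 'a) \<Rightarrow> 'a set \<Rightarrow> bool" where
  "maximal_subgroup S m G \<longleftrightarrow>
     subgroup_of S m G \<and> (\<forall>G'. subgroup_of S m G' \<and> G \<subseteq> G' \<longrightarrow> G' = G)"

(* In a completely regular semigroup each element lies in exactly one maximal subgroup. *)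
definition cr_inverse :: "'a set \<Rightarrow> ('a \<Rightarrow> 'a \<Rightarrow> 'a) \<Rightarrow> 'a \<Rightarrow> 'a" where
  "cr_inverse S m a =
     inv\<^bsub>monoid_record (THE G. maximal_subgroup S m G \<and> a \<in> G) m\<^esub> a"

definition cr_zero :: "'a set \<Rightarrow> ('a \<Rightarrow> 'a \<Rightarrow> 'a) \<Rightarrow> 'a \<Rightarrow> 'a" where
  "cr_zero S m a = m a (cr_inverse S m a)"

definition idempotents :: "'a set \<Rightarrow> ('a \<Rightarrow> 'a \<Rightarrow> 'a) \<Rightarrow> 'a set" where
  "idempotents S m = {e \<in> S. m e e = e}"

definition regular_semigroup :: "'a set \<Rightarrow> ('a \<Rightarrow> 'a \<Rightarrow> 'a) \<Rightarrow> bool" where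
  "regular_semigroup S m \<longleftrightarrow> semigroup_on S m \<and> (\<forall>a\<in>S. \<exists>x\<in>S. m (m a x) a = a)"

definition E_unitary :: "'a set \<Rightarrow> ('a \<Rightarrow> 'a \<Rightarrow> 'a) \<Rightarrow> bool" where
  "E_unitary T m \<longleftrightarrow> regular_semigroup T m \<and>
     (\<forall>e\<in>idempotents T m. \<forall>a\<in>T. m e a \<in> idempotents T m \<longrightarrow> a \<in> idempotents T m)"

(* Principal one-sided ideals S^1 a and a S^1. *)
definition left_ideal :: "'a set \<Rightarrow> ('a \<Rightarrow> 'a \<Rightarrow> 'a) \<Rightarrow> 'a \<Rightarrow> 'a set" where
  "left_ideal S m a = insert a {m s a |s. s \<in> S}"

definition right_ideal :: "'a set \<Rightarrow> ('a \<Rightarrow> 'a \<Rightarrow> 'a) \<Rightarrow> 'a \<Rightarrow> 'a set" where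
  "right_ideal S m a = insert a {m a s |s. s \<in> S}"

definition green_L :: "'a set \<Rightarrow> ('a \<Rightarrow> 'a \<Rightarrow> 'a) \<Rightarrow> 'a rel" where
  "green_L S m = {(a, b). a \<in> S \<and> b \<in> S \<and> left_ideal S m a = left_ideal S m b}"

definition green_R :: "'a set \<Rightarrow> ('a \<Rightarrow> 'a \<Rightarrow> 'a) \<Rightarrow> 'a rel" where
  "green_R S m = {(a, b). a \<in> S \<and> b \<in> S \<and> right_ideal S m a = right_ideal S m b}"

definition green_H :: "'a set \<Rightarrow> ('a \<Rightarrow> 'a \<Rightarrow> 'a) \<Rightarrow> 'a rel" where
  "green_H S m = green_L S m \<inter> green_R S m"

definition congruence_on :: "'a set \<Rightarrow> ('a \<Rightarrow> 'a \<Rightarrow> 'a) \<Rightarrow> 'a rel \<Rightarrow> bool" where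
  "congruence_on S m \<rho> \<longleftrightarrow> equiv S \<rho> \<and>
     (\<forall>a b c. (a, b) \<in> \<rho> \<and> c \<in> S \<longrightarrow> (m c a, m c b) \<in> \<rho> \<and> (m a c, m b c) \<in> \<rho>)"

definition cryptic :: "'a set \<Rightarrow> ('a \<Rightarrow> 'a \<Rightarrow> 'a) \<Rightarrow> bool" where
  "cryptic S m \<longleftrightarrow> congruence_on S m (green_H S m)"

(* Multiplication of classes in S // rho: for a congruence rho, the union below is the
   single class of m a b. *)
definition quotient_mult :: "('a \<Rightarrow> 'a \<Rightarrow> 'a) \<Rightarrow> 'a rel \<Rightarrow> 'a set \<Rightarrow> 'a set \<Rightarrow> 'a set" where
  "quotient_mult m \<rho> A B = (\<Union>a\<in>A. \<Union>b\<in>B. \<rho> `` {m a b})"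

definition group_congruence :: "'a set \<Rightarrow> ('a \<Rightarrow> 'a \<Rightarrow> 'a) \<Rightarrow> 'a rel \<Rightarrow> bool" where
  "group_congruence S m \<rho> \<longleftrightarrow> congruence_on S m \<rho> \<and> group_on (S // \<rho>) (quotient_mult m \<rho>)"

definition E_unitary_congruence :: "'a set \<Rightarrow> ('a \<Rightarrow> 'a \<Rightarrow> 'a) \<Rightarrow> 'a rel \<Rightarrow> bool" where
  "E_unitary_congruence S m \<rho> \<longleftrightarrow> congruence_on S m \<rho> \<and> E_unitary (S // \<rho>) (quotient_mult m \<rho>)"

definition cong_tr :: "'a set \<Rightarrow> ('a \<Rightarrow> 'a \<Rightarrow> 'a) \<Rightarrow> 'a rel \<Rightarrow> 'a rel" where
  "cong_tr S m \<rho> = \<rho> \<inter> (idempotents S m \<times> idempotents S m)"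

definition cong_ker :: "'a set \<Rightarrow> ('a \<Rightarrow> 'a \<Rightarrow> 'a) \<Rightarrow> 'a rel \<Rightarrow> 'a set" where
  "cong_ker S m \<rho> = {a \<in> S. \<exists>e\<in>idempotents S m. (a, e) \<in> \<rho>}"

definition idempotent_separating :: "'a set \<Rightarrow> ('a \<Rightarrow> 'a \<Rightarrow> 'a) \<Rightarrow> 'a rel \<Rightarrow> bool" where
  "idempotent_separating S m \<rho> \<longleftrightarrow>
     (\<forall>e\<in>idempotents S m. \<forall>f\<in>idempotents S m. (e, f) \<in> \<rho> \<longrightarrow> e = f)"

definition over_groups :: "'a set \<Rightarrow> ('a \<Rightarrow> 'a \<Rightarrow> 'a) \<Rightarrow> 'a rel \<Rightarrow> bool" where
  "over_groups S m \<rho> \<longleftrightarrow> (\<forall>C\<in>S // \<rho>. subsemigroup_of S m C \<longrightarrow> group_on C m)"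

(* Least and greatest are with respect to inclusion. Each of the four extremal congruences
   below exists in every completely regular semigroup. *)
definition sigma_cong :: "'a set \<Rightarrow> ('a \<Rightarrow> 'a \<Rightarrow> 'a) \<Rightarrow> 'a rel" where
  "sigma_cong S m = (LEAST \<rho>. group_congruence S m \<rho>)"

definition pi_cong :: "'a set \<Rightarrow> ('a \<Rightarrow> 'a \<Rightarrow> 'a) \<Rightarrow> 'a rel" where
  "pi_cong S m = (LEAST \<rho>. E_unitary_congruence S m \<rho>)"

definition mu_cong :: "'a set \<Rightarrow> ('a \<Rightarrow> 'a \<Rightarrow> 'a) \<Rightarrow> 'a rel" where
  "mu_cong S m = (GREATEST \<rho>. congruence_on S m \<rho> \<and> idempotent_separating S m \<rho>)"

definition least_same_tr :: "'a set \<Rightarrow> ('a \<Rightarrow> 'a \<Rightarrow> 'a) \<Rightarrow> 'a rel \<Rightarrow> 'a rel" where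
  "least_same_tr S m \<rho> = (LEAST \<tau>. congruence_on S m \<tau> \<and> cong_tr S m \<tau> = cong_tr S m \<rho>)"

definition Theta_rel :: "'a set \<Rightarrow> ('a \<Rightarrow> 'a \<Rightarrow> 'a) \<Rightarrow> 'a rel" where
  "Theta_rel S m = {(a, b). a \<in> S \<and> b \<in> S \<and> m (cr_zero S m a) b = m a (cr_zero S m b)}"

end

theory Submission
  imports Defs
begin

text \<open>In a completely regular semigroup \<open>a \<H> b\<close> means \<open>a\<^sup>0 = b\<^sup>0\<close>, so a congruence is idempotent
  separating iff it lies in \<open>\<H>\<close>; this makes (5), (6), (7), (8) and (9) restatements of the
  triviality of \<open>tr \<pi>\<close>. A congruence is \<open>E\<close>-unitary iff its kernel is unitary, and the syntactic
  congruence of \<open>ker \<pi>\<close> is a group congruence with kernel \<open>ker \<pi>\<close>, whence \<open>ker \<pi> = ker \<sigma>\<close>. If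
  \<open>ker \<sigma> \<subseteq> ker \<mu>\<close>, then \<open>\<sigma> \<inter> \<mu>\<close> has the unitary kernel \<open>ker \<sigma>\<close>, so \<open>\<pi> \<subseteq> \<sigma> \<inter> \<mu>\<close>. If \<open>ker \<sigma>\<close> is
  cryptic and \<open>a \<in> ker \<sigma>\<close>, then \<open>x a \<L> x\<^sup>0 a \<L> x\<^sup>0 a\<^sup>0 \<L> x a\<^sup>0\<close> and dually, and since \<open>\<L>\<close> and \<open>\<R>\<close>
  are one-sided congruences, \<open>a \<mu> a\<^sup>0\<close> follows.\<close>

section \<open>Groups and quotients\<close>

text \<open>The unit of \<open>monoid_record\<close> is a definite description; uniqueness of a
  two-sided identity evaluates it. From here on groups are handled through these axioms instead of
  records.\<close>

lemma group_on_iff: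
  "group_on G m \<longleftrightarrow>
     (\<forall>x\<in>G. \<forall>y\<in>G. m x y \<in> G) \<and>
     (\<forall>x\<in>G. \<forall>y\<in>G. \<forall>z\<in>G. m (m x y) z = m x (m y z)) \<and>
     (\<exists>e\<in>G. (\<forall>x\<in>G. m e x = x \<and> m x e = x) \<and> (\<forall>x\<in>G. \<exists>y\<in>G. m y x = e \<and> m x y = e))"
  (is "_ \<longleftrightarrow> ?closed \<and> ?assoc \<and> ?unit")
proof
  assume "group_on G m"
  then interpret G: group "monoid_record G m"
    by (simp add: group_on_def)
  show "?closed \<and> ?assoc \<and> ?unit"
  proof (intro conjI)
    show ?closed ?assoc
      using G.m_closed G.m_assoc by (simp_all add: monoid_record_def)
    show ?unit
    proof (rule bexI[where x = "\<one>\<^bsub>monoid_record G m\<^esub>"], intro conjI ballI)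
      fix x assume "x \<in> G"
      then have x: "x \<in> carrier (monoid_record G m)"
        by (simp add: monoid_record_def)
      show "m \<one>\<^bsub>monoid_record G m\<^esub> x = x" "m x \<one>\<^bsub>monoid_record G m\<^esub> = x"
        using G.l_one[OF x] G.r_one[OF x] by (simp_all add: monoid_record_def)
      show "\<exists>y\<in>G. m y x = \<one>\<^bsub>monoid_record G m\<^esub> \<and> m x y = \<one>\<^bsub>monoid_record G m\<^esub>"
        using G.l_inv[OF x] G.r_inv[OF x] G.inv_closed[OF x]
        by (intro bexI[where x = "inv\<^bsub>monoid_record G m\<^esub> x"]) (simp_all add: monoid_record_def)
    next
      show "\<one>\<^bsub>monoid_record G m\<^esub> \<in> G"
        using G.one_closed by (simp add: monoid_record_def)
    qed
  qed
next
  assume G: "?closed \<and> ?assoc \<and> ?unit"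
  then obtain e where e: "e \<in> G" "\<forall>x\<in>G. m e x = x \<and> m x e = x"
    and inv: "\<forall>x\<in>G. \<exists>y\<in>G. m y x = e \<and> m x y = e"
    by blast
  have "(THE e. e \<in> G \<and> (\<forall>x\<in>G. m e x = x \<and> m x e = x)) = e"
  proof (rule the_equality)
    show "f = e" if "f \<in> G \<and> (\<forall>x\<in>G. m f x = x \<and> m x f = x)" for f
      using that e by metis
  qed (use e in blast)
  then have one: "\<one>\<^bsub>monoid_record G m\<^esub> = e"
    by (simp add: monoid_record_def)
  show "group_on G m"
    unfolding group_on_def
    by (rule groupI, unfold one) (use G e inv in \<open>auto simp: monoid_record_def\<close>)
qed

text \<open>One-sided inverses in a group are inverses, so exhibiting a right inverse with respect
  to any known identity suffices. This is what evaluates \<open>cr_inverse\<close> later.\<close>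

lemma inv_monoid_recordI:
  assumes G: "group_on G m" and e: "e \<in> G" "\<forall>x\<in>G. m e x = x \<and> m x e = x"
    and xy: "x \<in> G" "y \<in> G" "m x y = e"
  shows "inv\<^bsub>monoid_record G m\<^esub> x = y"
proof -
  interpret G: group "monoid_record G m"
    using G by (simp add: group_on_def)
  have carrier: "carrier (monoid_record G m) = G"
    and mult: "monoid.mult (monoid_record G m) = m"
    by (simp_all add: monoid_record_def)
  have "\<one>\<^bsub>monoid_record G m\<^esub> = e"
    using e G.l_one[of e] G.one_closed unfolding carrier mult by metis
  then show ?thesis
    using G.inv_equality[of y x] G.inv_comm[of x y] xy unfolding carrier mult by simp
qed

section \<open>Congruences, their intersections and their quotients\<close>

lemma congruence_onD:
  assumes "congruence_on S m \<rho>"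
  shows congruence_on_refl: "a \<in> S \<Longrightarrow> (a, a) \<in> \<rho>"
    and congruence_on_sym: "(a, b) \<in> \<rho> \<Longrightarrow> (b, a) \<in> \<rho>"
    and congruence_on_trans: "\<lbrakk>(a, b) \<in> \<rho>; (b, c) \<in> \<rho>\<rbrakk> \<Longrightarrow> (a, c) \<in> \<rho>"
    and congruence_on_left: "\<lbrakk>(a, b) \<in> \<rho>; c \<in> S\<rbrakk> \<Longrightarrow> (m c a, m c b) \<in> \<rho>"
    and congruence_on_right: "\<lbrakk>(a, b) \<in> \<rho>; c \<in> S\<rbrakk> \<Longrightarrow> (m a c, m b c) \<in> \<rho>"
    and congruence_on_dom: "(a, b) \<in> \<rho> \<Longrightarrow> a \<in> S"
    and congruence_on_ran: "(a, b) \<in> \<rho> \<Longrightarrow> b \<in> S"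
proof -
  have eq: "equiv S \<rho>"
    and mult: "\<And>a b c. \<lbrakk>(a, b) \<in> \<rho>; c \<in> S\<rbrakk> \<Longrightarrow> (m c a, m c b) \<in> \<rho> \<and> (m a c, m b c) \<in> \<rho>"
    using assms by (simp_all add: congruence_on_def)
  show "a \<in> S \<Longrightarrow> (a, a) \<in> \<rho>" "(a, b) \<in> \<rho> \<Longrightarrow> (b, a) \<in> \<rho>"
    "\<lbrakk>(a, b) \<in> \<rho>; (b, c) \<in> \<rho>\<rbrakk> \<Longrightarrow> (a, c) \<in> \<rho>"
    using eq by (meson equivE refl_onD symD transD)+
  show "(a, b) \<in> \<rho> \<Longrightarrow> a \<in> S" "(a, b) \<in> \<rho> \<Longrightarrow> b \<in> S"
    using eq by (auto simp: equiv_def)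
  show "\<lbrakk>(a, b) \<in> \<rho>; c \<in> S\<rbrakk> \<Longrightarrow> (m c a, m c b) \<in> \<rho>"
    "\<lbrakk>(a, b) \<in> \<rho>; c \<in> S\<rbrakk> \<Longrightarrow> (m a c, m b c) \<in> \<rho>"
    using mult by blast+
qed

lemma congruence_onI:
  assumes "\<And>a b. (a, b) \<in> \<rho> \<Longrightarrow> a \<in> S \<and> b \<in> S"
    and "\<And>a. a \<in> S \<Longrightarrow> (a, a) \<in> \<rho>"
    and "\<And>a b. (a, b) \<in> \<rho> \<Longrightarrow> (b, a) \<in> \<rho>"
    and "\<And>a b c. \<lbrakk>(a, b) \<in> \<rho>; (b, c) \<in> \<rho>\<rbrakk> \<Longrightarrow> (a, c) \<in> \<rho>"
    and "\<And>a b c. \<lbrakk>(a, b) \<in> \<rho>; c \<in> S\<rbrakk> \<Longrightarrow> (m c a, m c b) \<in> \<rho>"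
    and "\<And>a b c. \<lbrakk>(a, b) \<in> \<rho>; c \<in> S\<rbrakk> \<Longrightarrow> (m a c, m b c) \<in> \<rho>"
  shows "congruence_on S m \<rho>"
proof -
  have "equiv S \<rho>"
  proof (rule equivI)
    show "\<rho> \<subseteq> S \<times> S"
      using assms(1) by auto
    show "refl_on S \<rho>"
      using assms(2) by (rule refl_onI)
    show "sym \<rho>"
      using assms(3) by (rule symI)
    show "trans \<rho>"
      using assms(4) by (rule transI)
  qed
  then show ?thesis
    using assms(5,6) by (simp add: congruence_on_def)
qed

text \<open>The family must be nonempty because \<open>\<Inter>{}\<close> is \<open>UNIV\<close>,
  which need not lie inside \<open>S \<times> S\<close>.\<close>

lemma congruence_on_Inter:
  assumes "\<And>\<rho>. \<rho> \<in> \<C> \<Longrightarrow> congruence_on S m \<rho>" and "\<C> \<noteq> {}"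
  shows "congruence_on S m (\<Inter>\<C>)"
proof (rule congruence_onI)
  show "a \<in> S \<and> b \<in> S" if "(a, b) \<in> \<Inter>\<C>" for a b
  proof -
    obtain \<rho> where "\<rho> \<in> \<C>"
      using assms(2) by blast
    then show ?thesis
      using that congruence_on_dom[OF assms(1)] congruence_on_ran[OF assms(1)] by blast
  qed
  show "(a, a) \<in> \<Inter>\<C>" if "a \<in> S" for a
    using that congruence_on_refl[OF assms(1)] by blast
  show "(b, a) \<in> \<Inter>\<C>" if "(a, b) \<in> \<Inter>\<C>" for a b
    using that congruence_on_sym[OF assms(1)] by blast
  show "(a, c) \<in> \<Inter>\<C>" if "(a, b) \<in> \<Inter>\<C>" "(b, c) \<in> \<Inter>\<C>" for a b c
    using that congruence_on_trans[OF assms(1)] by blast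
  show "(m c a, m c b) \<in> \<Inter>\<C>" if "(a, b) \<in> \<Inter>\<C>" "c \<in> S" for a b c
    using that congruence_on_left[OF assms(1)] by blast
  show "(m a c, m b c) \<in> \<Inter>\<C>" if "(a, b) \<in> \<Inter>\<C>" "c \<in> S" for a b c
    using that congruence_on_right[OF assms(1)] by blast
qed

lemma congruence_on_Int:
  assumes "congruence_on S m \<rho>" and "congruence_on S m \<tau>"
  shows "congruence_on S m (\<rho> \<inter> \<tau>)"
  using congruence_on_Inter[of "{\<rho>, \<tau>}" S m] assms by auto

text \<open>Makes \<open>LEAST\<close> usable: a property of relations that passes to the
  intersection of all its instances is least there. It serves \<sigma>, \<pi> and
  \<open>least_same_tr\<close>.\<close>

lemma Least_eq_Inter:
  fixes P :: "'a set \<Rightarrow> bool"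
  assumes "P (\<Inter>{X. P X})"
  shows "(LEAST X. P X) = \<Inter>{X. P X}"
  using assms by (intro Least_equality) auto

context semigroup_on
begin

lemma congruence_on_Times: "congruence_on S m (S \<times> S)"
  by (rule congruence_onI) (auto simp: closed)

lemma congruence_on_Id_on: "congruence_on S m (Id_on S)"
  by (rule congruence_onI) (auto simp: closed Id_on_iff)

lemma congruence_on_mult:
  assumes "congruence_on S m \<rho>" and "(a, b) \<in> \<rho>" and "(c, d) \<in> \<rho>"
  shows "(m a c, m b d) \<in> \<rho>"
proof -
  have "(m a c, m b c) \<in> \<rho>" "(m b c, m b d) \<in> \<rho>"
    using assms congruence_on_dom[OF assms(1,3)] congruence_on_ran[OF assms(1,2)]
    by (auto intro: congruence_on_left congruence_on_right)
  then show ?thesis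
    by (rule congruence_on_trans[OF assms(1)])
qed

lemma class_eq_iff:
  assumes "congruence_on S m \<rho>" and "a \<in> S" and "b \<in> S"
  shows "\<rho> `` {a} = \<rho> `` {b} \<longleftrightarrow> (a, b) \<in> \<rho>"
  using assms(1) eq_equiv_class_iff[OF _ assms(2,3)] unfolding congruence_on_def by blast

text \<open>By compatibility all products of representatives fall into one class, so the union in
  \<open>quotient_mult\<close> collapses.\<close>

lemma quotient_mult_classes:
  assumes \<rho>: "congruence_on S m \<rho>" and ab: "a \<in> S" "b \<in> S"
  shows "quotient_mult m \<rho> (\<rho> `` {a}) (\<rho> `` {b}) = \<rho> `` {m a b}"
proof -
  have "\<rho> `` {m x y} = \<rho> `` {m a b}" if "(a, x) \<in> \<rho>" "(b, y) \<in> \<rho>" for x y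
    using class_eq_iff[OF \<rho> closed[OF ab], of "m x y"] congruence_on_mult[OF \<rho> that]
      closed[OF congruence_on_ran[OF \<rho> that(1)] congruence_on_ran[OF \<rho> that(2)]]
    by simp
  moreover have "(a, a) \<in> \<rho>" "(b, b) \<in> \<rho>"
    using congruence_on_refl[OF \<rho>] ab by auto
  ultimately show ?thesis
    unfolding quotient_mult_def by blast
qed

lemma semigroup_on_quotient:
  assumes \<rho>: "congruence_on S m \<rho>"
  shows "semigroup_on (S // \<rho>) (quotient_mult m \<rho>)"
proof
  show "S // \<rho> \<noteq> {}"
    using nonempty by (simp add: quotient_is_empty)
  show "quotient_mult m \<rho> A B \<in> S // \<rho>" if "A \<in> S // \<rho>" "B \<in> S // \<rho>" for A B
    using that
    by (auto elim!: quotientE simp: quotient_mult_classes[OF \<rho>] closed intro!: quotientI)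
  show "quotient_mult m \<rho> (quotient_mult m \<rho> A B) C = quotient_mult m \<rho> A (quotient_mult m \<rho> B C)"
    if "A \<in> S // \<rho>" "B \<in> S // \<rho>" "C \<in> S // \<rho>" for A B C
    using that by (auto elim!: quotientE simp: quotient_mult_classes[OF \<rho>] closed assoc)
qed

end

section \<open>Semigroups with commuting inverses\<close>

text \<open>An equational form of complete regularity with the inverse as an explicit operation.
  Keeping \<open>\<iota>\<close> a parameter allows the same operation to serve both
  \<open>S\<close> and its subsemigroup \<open>ker_sigma\<close>, without recomputing maximal
  subgroups there.\<close>

locale commuting_inverses = semigroup_on S m
  for S :: "'a set" and m (infixl "\<cdot>" 70) +
  fixes \<iota> :: "'a \<Rightarrow> 'a"
  assumes inv_closed [simp]: "a \<in> S \<Longrightarrow> \<iota> a \<in> S"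
    and inv_commute: "a \<in> S \<Longrightarrow> \<iota> a \<cdot> a = a \<cdot> \<iota> a"
    and inv_regular: "a \<in> S \<Longrightarrow> a \<cdot> \<iota> a \<cdot> a = a"
    and inv_reflexive: "a \<in> S \<Longrightarrow> \<iota> a \<cdot> a \<cdot> \<iota> a = \<iota> a"
begin

declare closed [simp] assoc [simp]

text \<open>This is \<open>a\<^sup>0\<close> relative to \<open>\<iota>\<close>. It is built from
  \<open>m\<close> and \<open>\<iota>\<close> alone, so it does not change on passing to a
  subsemigroup closed under \<open>\<iota>\<close>.\<close>

definition zero :: "'a \<Rightarrow> 'a" (\<open>\<omega>\<close>) where
  "\<omega> a = a \<cdot> \<iota> a"

lemma zero_simps [simp]:
  assumes "a \<in> S"
  shows zero_closed: "\<omega> a \<in> S"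
    and mult_inv: "a \<cdot> \<iota> a = \<omega> a"
    and inv_mult: "\<iota> a \<cdot> a = \<omega> a"
    and mult_zero: "a \<cdot> \<omega> a = a"
    and zero_mult: "\<omega> a \<cdot> a = a"
    and inv_zero: "\<iota> a \<cdot> \<omega> a = \<iota> a"
    and zero_inv: "\<omega> a \<cdot> \<iota> a = \<iota> a"
    and zero_zero: "\<omega> a \<cdot> \<omega> a = \<omega> a"
proof -
  note facts = inv_commute[OF assms] inv_regular[OF assms] inv_reflexive[OF assms]
  show "\<omega> a \<in> S" "a \<cdot> \<iota> a = \<omega> a" "\<iota> a \<cdot> a = \<omega> a" "\<omega> a \<cdot> a = a"
    using assms facts(1,2) by (simp_all add: zero_def)
  show "\<iota> a \<cdot> \<omega> a = \<iota> a"
    using assms facts(3) by (simp add: zero_def)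
  show "a \<cdot> \<omega> a = a"
    using assms facts by (metis zero_def assoc inv_closed)
  show "\<omega> a \<cdot> \<iota> a = \<iota> a"
    using assms facts by (metis zero_def)
  show "\<omega> a \<cdot> \<omega> a = \<omega> a"
    using assms facts by (metis zero_def assoc closed inv_closed)
qed

text \<open>Since \<open>assoc\<close> as a rewrite rule nests products to the right, each
  cancellation is also required with a trailing factor.\<close>

lemma zero_simps_assoc [simp]:
  assumes "a \<in> S" and "b \<in> S"
  shows "a \<cdot> (\<iota> a \<cdot> b) = \<omega> a \<cdot> b" "\<iota> a \<cdot> (a \<cdot> b) = \<omega> a \<cdot> b"
    "a \<cdot> (\<omega> a \<cdot> b) = a \<cdot> b" "\<omega> a \<cdot> (a \<cdot> b) = a \<cdot> b"
    "\<iota> a \<cdot> (\<omega> a \<cdot> b) = \<iota> a \<cdot> b" "\<omega> a \<cdot> (\<iota> a \<cdot> b) = \<iota> a \<cdot> b"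
    "\<omega> a \<cdot> (\<omega> a \<cdot> b) = \<omega> a \<cdot> b"
  using assms by (simp_all flip: assoc)

lemma zero_idempotent [simp]: "a \<in> S \<Longrightarrow> \<omega> a \<in> idempotents S m"
  by (simp add: idempotents_def)

lemma zero_of_idempotent:
  assumes "e \<in> idempotents S m"
  shows "\<omega> e = e"
proof -
  have e: "e \<in> S" "e \<cdot> e = e"
    using assms by (auto simp: idempotents_def)
  \<comment> \<open>Cancellation gives \<open>e\<close>, while \<open>e \<cdot> e = e\<close>
    reduces the same product to \<open>\<omega> e\<close>.\<close>
  have "\<iota> e \<cdot> (e \<cdot> e) = e"
    using e(1) by simp
  then show ?thesis
    using e by simp
qed

lemma zero_idem [simp]: "a \<in> S \<Longrightarrow> \<omega> (\<omega> a) = \<omega> a"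
  by (simp add: zero_of_idempotent)

section \<open>Green's relations expressed by divisibility and by \<omega>\<close>

lemma green_L_iff: "(a, b) \<in> green_L S m \<longleftrightarrow> a \<in> S \<and> b \<in> S \<and> (\<exists>s\<in>S. a = s \<cdot> b) \<and> (\<exists>s\<in>S. b = s \<cdot> a)"
proof -
  \<comment> \<open>Because \<open>a = \<omega> a \<cdot> a\<close>, adjoining \<open>a\<close> to
    \<open>S a\<close> changes nothing, and inclusion of ideals becomes divisibility.\<close>
  have self: "a \<in> {s \<cdot> a |s. s \<in> S}" if "a \<in> S" for a
    using zero_mult[OF that, symmetric] zero_closed[OF that] by blast
  then have ideal: "left_ideal S m a = {s \<cdot> a |s. s \<in> S}" if "a \<in> S" for a
    using that by (simp add: left_ideal_def insert_absorb)
  have sub: "{s \<cdot> a |s. s \<in> S} \<subseteq> {s \<cdot> b |s. s \<in> S} \<longleftrightarrow> (\<exists>s\<in>S. a = s \<cdot> b)"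
    if "a \<in> S" "b \<in> S" for a b
  proof
    show "\<exists>s\<in>S. a = s \<cdot> b" if "{s \<cdot> a |s. s \<in> S} \<subseteq> {s \<cdot> b |s. s \<in> S}"
      using that self[OF \<open>a \<in> S\<close>] by blast
    show "{s \<cdot> a |s. s \<in> S} \<subseteq> {s \<cdot> b |s. s \<in> S}" if ex: "\<exists>s\<in>S. a = s \<cdot> b"
    proof clarify
      fix t assume t: "t \<in> S"
      obtain s where s: "s \<in> S" "a = s \<cdot> b"
        using ex by blast
      then show "\<exists>u. t \<cdot> a = u \<cdot> b \<and> u \<in> S"
        using t \<open>b \<in> S\<close> by (intro exI[of _ "t \<cdot> s"]) simp
    qed
  qed
  show ?thesis
    unfolding green_L_def by (simp add: ideal set_eq_subset sub cong: conj_cong)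
qed

lemma green_R_iff: "(a, b) \<in> green_R S m \<longleftrightarrow> a \<in> S \<and> b \<in> S \<and> (\<exists>s\<in>S. a = b \<cdot> s) \<and> (\<exists>s\<in>S. b = a \<cdot> s)"
proof -
  have self: "a \<in> {a \<cdot> s |s. s \<in> S}" if "a \<in> S" for a
    using mult_zero[OF that, symmetric] zero_closed[OF that] by blast
  then have ideal: "right_ideal S m a = {a \<cdot> s |s. s \<in> S}" if "a \<in> S" for a
    using that by (simp add: right_ideal_def insert_absorb)
  have sub: "{a \<cdot> s |s. s \<in> S} \<subseteq> {b \<cdot> s |s. s \<in> S} \<longleftrightarrow> (\<exists>s\<in>S. a = b \<cdot> s)"
    if "a \<in> S" "b \<in> S" for a b
  proof
    show "\<exists>s\<in>S. a = b \<cdot> s" if "{a \<cdot> s |s. s \<in> S} \<subseteq> {b \<cdot> s |s. s \<in> S}"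
      using that self[OF \<open>a \<in> S\<close>] by blast
    show "{a \<cdot> s |s. s \<in> S} \<subseteq> {b \<cdot> s |s. s \<in> S}" if ex: "\<exists>s\<in>S. a = b \<cdot> s"
    proof clarify
      fix t assume t: "t \<in> S"
      obtain s where s: "s \<in> S" "a = b \<cdot> s"
        using ex by blast
      then show "\<exists>u. a \<cdot> t = b \<cdot> u \<and> u \<in> S"
        using t \<open>b \<in> S\<close> by (intro exI[of _ "s \<cdot> t"]) simp
    qed
  qed
  show ?thesis
    unfolding green_R_def by (simp add: ideal set_eq_subset sub cong: conj_cong)
qed

lemma green_L_right: "\<lbrakk>(a, b) \<in> green_L S m; c \<in> S\<rbrakk> \<Longrightarrow> (a \<cdot> c, b \<cdot> c) \<in> green_L S m"
  unfolding green_L_iff by (metis assoc closed)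

lemma green_R_left: "\<lbrakk>(a, b) \<in> green_R S m; c \<in> S\<rbrakk> \<Longrightarrow> (c \<cdot> a, c \<cdot> b) \<in> green_R S m"
  unfolding green_R_iff by (metis assoc closed)

text \<open>If \<open>a\<close> and \<open>b\<close> are \<H>-related,
  \<open>\<omega> a \<cdot> \<omega> b\<close> equals both of its factors; conversely \<open>a = (a
  \<cdot> \<iota> b) \<cdot> b = b \<cdot> (\<iota> b \<cdot> a)\<close>. The right side mentions
  the ambient semigroup only through membership, so \<H> of \<open>ker_sigma\<close> can be compared
  with \<H> of \<open>S\<close>.\<close>

lemma green_H_iff: "(a, b) \<in> green_H S m \<longleftrightarrow> a \<in> S \<and> b \<in> S \<and> \<omega> a = \<omega> b"
proof
  assume "(a, b) \<in> green_H S m"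
  then have "(a, b) \<in> green_L S m" "(a, b) \<in> green_R S m"
    by (simp_all add: green_H_def)
  then obtain s t where ab: "a \<in> S" "b \<in> S" and s: "s \<in> S" "a = s \<cdot> b" and t: "t \<in> S" "b = a \<cdot> t"
    unfolding green_L_iff green_R_iff by blast
  have "a \<cdot> \<omega> b = a" "\<omega> a \<cdot> b = b"
    using ab s t by (metis assoc mult_zero zero_closed, metis assoc zero_mult zero_closed)
  then have "\<omega> a \<cdot> \<omega> b = \<omega> a" "\<omega> a \<cdot> \<omega> b = \<omega> b"
    using ab by (metis assoc inv_closed inv_mult zero_closed,
        metis assoc inv_closed mult_inv zero_closed)
  then show "a \<in> S \<and> b \<in> S \<and> \<omega> a = \<omega> b"
    using ab by simp
next
  have "\<exists>s\<in>S. a = s \<cdot> b" "\<exists>s\<in>S. a = b \<cdot> s" if "a \<in> S" "b \<in> S" "\<omega> a = \<omega> b" for a b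
  proof -
    have "a = (a \<cdot> \<iota> b) \<cdot> b" "a = b \<cdot> (\<iota> b \<cdot> a)"
      using that mult_zero[of a] zero_mult[of a] by simp_all
    then show "\<exists>s\<in>S. a = s \<cdot> b" "\<exists>s\<in>S. a = b \<cdot> s"
      using that by (metis closed inv_closed)+
  qed
  then show "(a, b) \<in> green_H S m" if "a \<in> S \<and> b \<in> S \<and> \<omega> a = \<omega> b"
    using that unfolding green_H_def Int_iff green_L_iff green_R_iff by (metis (full_types))
qed

section \<open>Kernels and traces\<close>

text \<open>Both \<open>\<omega> a\<close> and \<open>\<omega> b\<close> are congruent to
  \<open>\<omega> b \<cdot> \<omega> a\<close>: the first through
  \<open>b \<cdot> \<iota> a\<close>, the second through \<open>\<iota> b \<cdot> a\<close>.\<close>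

lemma congruence_on_zero:
  assumes \<rho>: "congruence_on S m \<rho>" and ab: "(a, b) \<in> \<rho>"
  shows "(\<omega> a, \<omega> b) \<in> \<rho>"
proof -
  note S [simp] = congruence_on_dom[OF \<rho> ab] congruence_on_ran[OF \<rho> ab]
  have "(\<omega> b \<cdot> a, b) \<in> \<rho>" "(\<omega> a, b \<cdot> \<iota> a) \<in> \<rho>"
    using congruence_on_left[OF \<rho> ab, of "\<omega> b"] congruence_on_right[OF \<rho> ab, of "\<iota> a"] by simp_all
  then have "(\<omega> b \<cdot> \<omega> a, \<omega> a) \<in> \<rho>"
    using congruence_on_right[OF \<rho>, of "\<omega> b \<cdot> a" b "\<iota> a"]
    by (simp, meson \<rho> congruence_on_sym congruence_on_trans)
  moreover have "(\<omega> b \<cdot> \<omega> a, \<iota> b \<cdot> a) \<in> \<rho>" "(\<iota> b \<cdot> a, \<omega> b) \<in> \<rho>"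
    using congruence_on_left[OF \<rho> congruence_on_right[OF \<rho> congruence_on_sym[OF \<rho> ab], of "\<omega> a"],
        of "\<iota> b"] congruence_on_left[OF \<rho> ab, of "\<iota> b"] by simp_all
  ultimately show ?thesis
    by (meson \<rho> congruence_on_sym congruence_on_trans)
qed

text \<open>If \<open>a\<close> is congruent to an idempotent \<open>e\<close>, then
  \<open>\<omega> a\<close> is congruent to \<open>\<omega> e = e\<close>. The existential witness
  can therefore always be \<open>\<omega> a\<close>, independently of the congruence.\<close>

lemma cong_ker_iff:
  assumes \<rho>: "congruence_on S m \<rho>"
  shows "a \<in> cong_ker S m \<rho> \<longleftrightarrow> (a, \<omega> a) \<in> \<rho>"
proof
  assume "a \<in> cong_ker S m \<rho>"
  then obtain e where e: "e \<in> idempotents S m" "(a, e) \<in> \<rho>"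
    unfolding cong_ker_def by blast
  then show "(a, \<omega> a) \<in> \<rho>"
    using congruence_on_zero[OF \<rho> e(2)] zero_of_idempotent[OF e(1)]
      congruence_on_sym[OF \<rho>] congruence_on_trans[OF \<rho>] by metis
next
  show "a \<in> cong_ker S m \<rho>" if "(a, \<omega> a) \<in> \<rho>"
    using that congruence_on_dom[OF \<rho> that] unfolding cong_ker_def by auto
qed

text \<open>Kernel elements are those whose class is an idempotent of the quotient. Left
  multiplication by \<open>a\<close> and by \<open>\<iota> a\<close> passes between the two
  forms.\<close>

lemma cong_ker_iff_square:
  assumes \<rho>: "congruence_on S m \<rho>" and a: "a \<in> S"
  shows "a \<in> cong_ker S m \<rho> \<longleftrightarrow> (a \<cdot> a, a) \<in> \<rho>"
proof -
  have "(a \<cdot> a, a) \<in> \<rho>" if "(a, \<omega> a) \<in> \<rho>"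
    using congruence_on_left[OF \<rho> that a] a by simp
  moreover have "(a, \<omega> a) \<in> \<rho>" if "(a \<cdot> a, a) \<in> \<rho>"
    using congruence_on_left[OF \<rho> that, of "\<iota> a"] a by simp
  ultimately show ?thesis
    by (auto simp: cong_ker_iff[OF \<rho>])
qed

lemma idempotent_in_cong_ker:
  "\<lbrakk>congruence_on S m \<rho>; e \<in> idempotents S m\<rbrakk> \<Longrightarrow> e \<in> cong_ker S m \<rho>"
  unfolding cong_ker_def idempotents_def by (auto dest: congruence_on_refl)

lemma inv_in_cong_ker:
  assumes \<rho>: "congruence_on S m \<rho>" and a: "a \<in> cong_ker S m \<rho>"
  shows "\<iota> a \<in> cong_ker S m \<rho>"
proof -
  have S: "a \<in> S"
    using a by (simp add: cong_ker_def)
  have "(a, \<omega> a) \<in> \<rho>"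
    using a by (simp add: cong_ker_iff[OF \<rho>])
  then have "(\<omega> a, \<iota> a) \<in> \<rho>"
    using congruence_on_left[OF \<rho>, of a "\<omega> a" "\<iota> a"] S by simp
  then show ?thesis
    using S congruence_on_sym[OF \<rho>] unfolding cong_ker_def by (auto intro!: bexI[of _ "\<omega> a"])
qed

text \<open>Related \<open>a\<close> and \<open>b\<close> have related idempotents
  \<open>\<omega> a\<close> and \<open>\<omega> b\<close>, which separation makes equal; conversely
  \<omega> fixes idempotents, so \<H>-related idempotents coincide.\<close>

lemma idempotent_separating_iff:
  assumes \<rho>: "congruence_on S m \<rho>"
  shows "idempotent_separating S m \<rho> \<longleftrightarrow> \<rho> \<subseteq> green_H S m"
proof
  assume "idempotent_separating S m \<rho>"
  then show "\<rho> \<subseteq> green_H S m"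
    using congruence_on_zero[OF \<rho>] congruence_on_dom[OF \<rho>] congruence_on_ran[OF \<rho>]
    unfolding idempotent_separating_def by (auto simp: green_H_iff)
next
  show "idempotent_separating S m \<rho>" if "\<rho> \<subseteq> green_H S m"
    using that zero_of_idempotent unfolding idempotent_separating_def
    by (metis green_H_iff subsetD)
qed

text \<open>The equation is oriented as the condition under which \<open>Id_on S\<close> belongs to
  the family defining \<open>least_same_tr S m \<rho>\<close>.\<close>

lemma idempotent_separating_iff_tr:
  assumes \<rho>: "congruence_on S m \<rho>"
  shows "idempotent_separating S m \<rho> \<longleftrightarrow> cong_tr S m (Id_on S) = cong_tr S m \<rho>"
proof
  assume sep: "idempotent_separating S m \<rho>"
  show "cong_tr S m (Id_on S) = cong_tr S m \<rho>"
  proof (intro equalityI subrelI)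
    show "(e, f) \<in> cong_tr S m \<rho>" if "(e, f) \<in> cong_tr S m (Id_on S)" for e f
      using that congruence_on_refl[OF \<rho>] by (auto simp: cong_tr_def Id_on_iff)
    show "(e, f) \<in> cong_tr S m (Id_on S)" if "(e, f) \<in> cong_tr S m \<rho>" for e f
    proof -
      have ef: "(e, f) \<in> \<rho>" "e \<in> idempotents S m" "f \<in> idempotents S m"
        using that by (simp_all add: cong_tr_def)
      then have "e = f"
        using sep unfolding idempotent_separating_def by blast
      then show ?thesis
        using ef congruence_on_dom[OF \<rho> ef(1)] by (simp add: cong_tr_def Id_on_iff)
    qed
  qed
next
  assume tr: "cong_tr S m (Id_on S) = cong_tr S m \<rho>"
  show "idempotent_separating S m \<rho>"
    unfolding idempotent_separating_def
  proof (intro ballI impI)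
    fix e f assume "e \<in> idempotents S m" "f \<in> idempotents S m" "(e, f) \<in> \<rho>"
    then have "(e, f) \<in> cong_tr S m \<rho>"
      by (simp add: cong_tr_def)
    then show "e = f"
      unfolding tr[symmetric] by (simp add: cong_tr_def Id_on_iff)
  qed
qed

text \<open>A class closed under products contains \<open>c\<close> and \<open>c \<cdot> c\<close>,
  hence \<open>\<omega> c\<close>; if \<rho> lies in \<H>, every member has this same idempotent and
  the class is a group. Conversely the class of an idempotent is closed under products, and a group
  has only one idempotent.\<close>

lemma idempotent_separating_iff_over_groups:
  assumes \<rho>: "congruence_on S m \<rho>"
  shows "idempotent_separating S m \<rho> \<longleftrightarrow> over_groups S m \<rho>"
proof
  assume "idempotent_separating S m \<rho>"
  then have H: "\<rho> \<subseteq> green_H S m"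
    using idempotent_separating_iff[OF \<rho>] by blast
  show "over_groups S m \<rho>"
    unfolding over_groups_def
  proof (intro ballI impI)
    fix C assume C: "C \<in> S // \<rho>" and sub: "subsemigroup_of S m C"
    then obtain c where c: "c \<in> S" "C = \<rho> `` {c}"
      by (auto elim: quotientE)
    have closedC: "x \<cdot> y \<in> C" if "x \<in> C" "y \<in> C" for x y
      using sub semigroup_on.closed[OF _ that, of m] by (simp add: subsemigroup_of_def)
    have "c \<in> C"
      using c congruence_on_refl[OF \<rho>] by simp
    then have "c \<cdot> c \<in> C"
      using closedC by blast
    then have "c \<in> cong_ker S m \<rho>"
      using c congruence_on_sym[OF \<rho>] by (simp add: cong_ker_iff_square[OF \<rho>])
    then have c0: "(c, \<omega> c) \<in> \<rho>"
      by (simp add: cong_ker_iff[OF \<rho>])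
    have mem: "x \<in> S" "\<omega> x = \<omega> c" "(x, \<omega> c) \<in> \<rho>" if "x \<in> C" for x
    proof -
      have cx: "(c, x) \<in> \<rho>"
        using that c by simp
      then show "x \<in> S" "\<omega> x = \<omega> c"
        using H green_H_iff by auto
      show "(x, \<omega> c) \<in> \<rho>"
        using cx c0 congruence_on_sym[OF \<rho>] congruence_on_trans[OF \<rho>] by blast
    qed
    have inv: "\<iota> x \<in> C" if "x \<in> C" for x
    proof -
      have "(\<omega> c, \<iota> x) \<in> \<rho>"
        using congruence_on_left[OF \<rho> mem(3)[OF that], of "\<iota> x"] mem(1,2)[OF that] inv_zero[of x]
        by simp
      then show ?thesis
        using c(2) congruence_on_trans[OF \<rho> c0] by simp
    qed
    show "group_on C m"
      unfolding group_on_iff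
    proof (intro conjI)
      show "\<forall>x\<in>C. \<forall>y\<in>C. x \<cdot> y \<in> C"
        using closedC by blast
      show "\<forall>x\<in>C. \<forall>y\<in>C. \<forall>z\<in>C. x \<cdot> y \<cdot> z = x \<cdot> (y \<cdot> z)"
        using mem(1) by simp
      have "\<omega> c \<in> C"
        using c c0 by simp
      moreover have "\<omega> c \<cdot> x = x \<and> x \<cdot> \<omega> c = x" if "x \<in> C" for x
        using mem(1,2)[OF that] mult_zero[of x] zero_mult[of x] by simp
      moreover have "\<iota> x \<cdot> x = \<omega> c \<and> x \<cdot> \<iota> x = \<omega> c" if "x \<in> C" for x
        using mem(1,2)[OF that] by simp
      ultimately show "\<exists>e\<in>C. (\<forall>x\<in>C. e \<cdot> x = x \<and> x \<cdot> e = x)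
          \<and> (\<forall>x\<in>C. \<exists>y\<in>C. y \<cdot> x = e \<and> x \<cdot> y = e)"
        using inv by blast
    qed
  qed
next
  assume over: "over_groups S m \<rho>"
  show "idempotent_separating S m \<rho>"
    unfolding idempotent_separating_def
  proof (intro ballI impI)
    fix e f assume e: "e \<in> idempotents S m" and f: "f \<in> idempotents S m" and ef: "(e, f) \<in> \<rho>"
    define C where "C = \<rho> `` {e}"
    have eS: "e \<in> S" "e \<cdot> e = e" and fS: "f \<in> S" "f \<cdot> f = f"
      using e f by (auto simp: idempotents_def)
    have CS: "C \<subseteq> S"
      using congruence_on_ran[OF \<rho>] unfolding C_def by auto
    have eC: "e \<in> C" and fC: "f \<in> C"
      using ef congruence_on_refl[OF \<rho>] eS unfolding C_def by auto
    have "x \<cdot> y \<in> C" if "x \<in> C" "y \<in> C" for x y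
      using that congruence_on_mult[OF \<rho>, of e x e y] eS unfolding C_def by auto
    then have "subsemigroup_of S m C"
      unfolding subsemigroup_of_def semigroup_on_def using CS eC by (auto simp: subset_iff)
    then have "group_on C m"
      using over eS unfolding over_groups_def C_def by (auto intro: quotientI)
    then obtain u where u: "\<forall>x\<in>C. u \<cdot> x = x \<and> x \<cdot> u = x" "\<forall>x\<in>C. \<exists>y\<in>C. y \<cdot> x = u \<and> x \<cdot> y = u"
      unfolding group_on_iff by auto
    have "x = u" if x: "x \<in> C" "x \<cdot> x = x" for x
    proof -
      obtain y where y: "y \<in> C" "y \<cdot> x = u"
        using u(2) x(1) by auto
      have "y \<cdot> x \<cdot> x = y \<cdot> x"
        using CS x y(1) by (simp add: subset_iff)
      then show ?thesis
        using y(2) u(1) x(1) by simp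
    qed
    then show "e = f"
      using eC fC eS fS by metis
  qed
qed

end

section \<open>Kernels of products in either order and of intersections\<close>

context commuting_inverses
begin

text \<open>Multiplying \<open>(a \<cdot> b) \<cdot> (a \<cdot> b)\<close> and
  \<open>a \<cdot> b\<close> by \<open>b\<close> on the left and \<open>a\<close> on the right
  relates the cube of \<open>u = b \<cdot> a\<close> to its square; multiplying by
  \<open>\<iota> u\<close> lowers both exponents by one.\<close>

lemma cong_ker_mult_commute:
  assumes \<rho>: "congruence_on S m \<rho>" and S: "a \<in> S" "b \<in> S" and ab: "a \<cdot> b \<in> cong_ker S m \<rho>"
  shows "b \<cdot> a \<in> cong_ker S m \<rho>"
proof -
  define u where "u = b \<cdot> a"
  have u: "u \<in> S"
    using S by (simp add: u_def)
  have "((a \<cdot> b) \<cdot> (a \<cdot> b), a \<cdot> b) \<in> \<rho>"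
    using ab cong_ker_iff_square[OF \<rho> closed[OF S]] by blast
  from congruence_on_left[OF \<rho> congruence_on_right[OF \<rho> this S(1)] S(2)]
  have "(u \<cdot> (u \<cdot> u), u \<cdot> u) \<in> \<rho>"
    using S by (simp add: u_def)
  from congruence_on_left[OF \<rho> this, of "\<iota> u"] have "(u \<cdot> u, u) \<in> \<rho>"
    using u by simp
  then show ?thesis
    using cong_ker_iff_square[OF \<rho> u] by (simp add: u_def)
qed

text \<open>Kernels commute with intersections because one witness, \<open>\<omega> a\<close>, works
  for every congruence of the family at once.\<close>

lemma cong_ker_Inter:
  assumes "\<And>\<rho>. \<rho> \<in> \<C> \<Longrightarrow> congruence_on S m \<rho>" and "\<C> \<noteq> {}"
  shows "cong_ker S m (\<Inter>\<C>) = (\<Inter>\<rho>\<in>\<C>. cong_ker S m \<rho>)"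
proof -
  have "a \<in> cong_ker S m (\<Inter>\<C>) \<longleftrightarrow> a \<in> (\<Inter>\<rho>\<in>\<C>. cong_ker S m \<rho>)" for a
    using cong_ker_iff[OF congruence_on_Inter[OF assms]] cong_ker_iff[OF assms(1)] by simp
  then show ?thesis
    by blast
qed

section \<open>Group congruences and E-unitary congruences\<close>

text \<open>A group has a single idempotent, so the quotient identifies all idempotents. Conversely
  the common class of all \<open>\<omega> a\<close> is an identity, and the class of
  \<open>\<iota> a\<close> is inverse to that of \<open>a\<close>.\<close>

lemma group_congruence_iff:
  "group_congruence S m \<rho> \<longleftrightarrow>
     congruence_on S m \<rho> \<and> (\<forall>e\<in>idempotents S m. \<forall>f\<in>idempotents S m. (e, f) \<in> \<rho>)"
proof (cases "congruence_on S m \<rho>")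
  case \<rho>: True
  let ?Q = "S // \<rho>" and ?q = "quotient_mult m \<rho>"
  interpret Q: semigroup_on ?Q ?q
    by (rule semigroup_on_quotient[OF \<rho>])
  have "(e, f) \<in> \<rho>"
    if G: "group_on ?Q ?q" and e: "e \<in> idempotents S m" and f: "f \<in> idempotents S m" for e f
  proof -
    have eS: "e \<in> S" "e \<cdot> e = e" and fS: "f \<in> S" "f \<cdot> f = f"
      using e f by (auto simp: idempotents_def)
    obtain u where u: "\<forall>X\<in>?Q. ?q u X = X \<and> ?q X u = X" "\<forall>X\<in>?Q. \<exists>Y\<in>?Q. ?q Y X = u \<and> ?q X Y = u"
      using G unfolding group_on_iff by auto
    have "X = u" if X: "X \<in> ?Q" "?q X X = X" for X
    proof -
      obtain Y where Y: "Y \<in> ?Q" "?q Y X = u"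
        using u(2) X(1) by auto
      have "?q (?q Y X) X = ?q Y X"
        using Q.assoc[OF Y(1) X(1) X(1)] X(2) by simp
      then show ?thesis
        using Y(2) u(1) X(1) by simp
    qed
    then have "\<rho> `` {x} = u" if "x \<in> S" "x \<cdot> x = x" for x
      using that by (simp add: quotient_mult_classes[OF \<rho>] quotientI)
    then have "\<rho> `` {e} = \<rho> `` {f}"
      using eS fS by blast
    then show ?thesis
      using class_eq_iff[OF \<rho> eS(1) fS(1)] by blast
  qed
  moreover have "group_on ?Q ?q"
    if E: "\<forall>e\<in>idempotents S m. \<forall>f\<in>idempotents S m. (e, f) \<in> \<rho>"
    unfolding group_on_iff
  proof (intro conjI)
    show "\<forall>X\<in>?Q. \<forall>Y\<in>?Q. ?q X Y \<in> ?Q"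
      using Q.closed by blast
    show "\<forall>X\<in>?Q. \<forall>Y\<in>?Q. \<forall>Z\<in>?Q. ?q (?q X Y) Z = ?q X (?q Y Z)"
      using Q.assoc by blast
    obtain s where s: "s \<in> S"
      using nonempty by blast
    have zero_class: "\<rho> `` {\<omega> a} = \<rho> `` {\<omega> s}" if "a \<in> S" for a
      using class_eq_iff[OF \<rho>] E s that by simp
    show "\<exists>U\<in>?Q. (\<forall>X\<in>?Q. ?q U X = X \<and> ?q X U = X) \<and> (\<forall>X\<in>?Q. \<exists>Y\<in>?Q. ?q Y X = U \<and> ?q X Y = U)"
    proof (rule bexI[where x = "\<rho> `` {\<omega> s}"], intro conjI ballI)
      fix X assume "X \<in> ?Q"
      then obtain a where a: "a \<in> S" "X = \<rho> `` {a}"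
        by (auto elim: quotientE)
      have "?q (\<rho> `` {\<omega> a}) X = X" "?q X (\<rho> `` {\<omega> a}) = X"
        using a by (simp_all add: quotient_mult_classes[OF \<rho>])
      then show "?q (\<rho> `` {\<omega> s}) X = X" "?q X (\<rho> `` {\<omega> s}) = X"
        using zero_class[OF a(1)] by simp_all
      show "\<exists>Y\<in>?Q. ?q Y X = \<rho> `` {\<omega> s} \<and> ?q X Y = \<rho> `` {\<omega> s}"
        using a zero_class[OF a(1)]
        by (intro bexI[where x = "\<rho> `` {\<iota> a}"])
          (simp_all add: quotient_mult_classes[OF \<rho>] quotientI)
    next
      show "\<rho> `` {\<omega> s} \<in> ?Q"
        using s by (simp add: quotientI)
    qed
  qed
  ultimately show ?thesis
    using \<rho> by (auto simp: group_congruence_def)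
qed (simp add: group_congruence_def)

text \<open>The idempotents of the quotient are exactly the classes of kernel elements, and classes
  of \<open>\<iota> a\<close> witness regularity. Whether a congruence is E-unitary thus depends on
  its kernel alone.\<close>

lemma E_unitary_congruence_iff:
  "E_unitary_congruence S m \<rho> \<longleftrightarrow>
     congruence_on S m \<rho> \<and>
     (\<forall>x\<in>cong_ker S m \<rho>. \<forall>a\<in>S. x \<cdot> a \<in> cong_ker S m \<rho> \<longrightarrow> a \<in> cong_ker S m \<rho>)"
proof (cases "congruence_on S m \<rho>")
  case \<rho>: True
  let ?Q = "S // \<rho>" and ?q = "quotient_mult m \<rho>"
  interpret Q: semigroup_on ?Q ?q
    by (rule semigroup_on_quotient[OF \<rho>])
  have "\<exists>Y\<in>?Q. ?q (?q X Y) X = X" if X: "X \<in> ?Q" for X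
  proof -
    obtain a where "a \<in> S" "X = \<rho> `` {a}"
      using X by (auto elim: quotientE)
    then show ?thesis
      by (intro bexI[where x = "\<rho> `` {\<iota> a}"]) (simp_all add: quotient_mult_classes[OF \<rho>] quotientI)
  qed
  then have "regular_semigroup ?Q ?q"
    unfolding regular_semigroup_def using Q.semigroup_on_axioms by blast
  moreover have idem: "\<rho> `` {a} \<in> idempotents ?Q ?q \<longleftrightarrow> a \<in> cong_ker S m \<rho>" if "a \<in> S" for a
    using that unfolding idempotents_def
    by (simp add: quotient_mult_classes[OF \<rho>] quotientI class_eq_iff[OF \<rho>]
        cong_ker_iff_square[OF \<rho>])
  have "(\<forall>X\<in>idempotents ?Q ?q. \<forall>A\<in>?Q. ?q X A \<in> idempotents ?Q ?q \<longrightarrow> A \<in> idempotents ?Q ?q) \<longleftrightarrow>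
      (\<forall>x\<in>cong_ker S m \<rho>. \<forall>a\<in>S. x \<cdot> a \<in> cong_ker S m \<rho> \<longrightarrow> a \<in> cong_ker S m \<rho>)" (is "?L \<longleftrightarrow> ?R")
  proof
    assume ?L
    show ?R
    proof (intro ballI impI)
      fix x a assume x: "x \<in> cong_ker S m \<rho>" and a: "a \<in> S" "x \<cdot> a \<in> cong_ker S m \<rho>"
      have xS: "x \<in> S"
        using x by (simp add: cong_ker_def)
      have "?q (\<rho> `` {x}) (\<rho> `` {a}) \<in> idempotents ?Q ?q"
        using xS a idem[of "x \<cdot> a"] by (simp add: quotient_mult_classes[OF \<rho>])
      then show "a \<in> cong_ker S m \<rho>"
        using \<open>?L\<close> idem[OF xS] idem[OF a(1)] x quotientI[OF a(1)] by blast
    qed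
  next
    assume ?R
    show ?L
    proof (intro ballI impI)
      fix X A assume X: "X \<in> idempotents ?Q ?q" and A: "A \<in> ?Q" "?q X A \<in> idempotents ?Q ?q"
      obtain x a where x: "x \<in> S" "X = \<rho> `` {x}" and a: "a \<in> S" "A = \<rho> `` {a}"
        using X A(1) unfolding idempotents_def by (auto elim!: quotientE)
      have "x \<in> cong_ker S m \<rho>" "x \<cdot> a \<in> cong_ker S m \<rho>"
        using X A(2) x a idem by (simp_all add: quotient_mult_classes[OF \<rho>])
      then show "A \<in> idempotents ?Q ?q"
        using \<open>?R\<close> a idem by blast
    qed
  qed
  ultimately show ?thesis
    using \<rho> by (simp add: E_unitary_congruence_def E_unitary_def)
qed (simp add: E_unitary_congruence_def)

text \<open>All idempotents are identified, so a kernel element \<open>x\<close> acts as an identity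
  modulo \<rho>, and \<open>x \<cdot> a\<close> is congruent to \<open>a\<close>.\<close>

lemma group_congruence_imp_E_unitary:
  assumes "group_congruence S m \<rho>"
  shows "E_unitary_congruence S m \<rho>"
proof -
  have \<rho>: "congruence_on S m \<rho>" and E: "\<And>a b. \<lbrakk>a \<in> S; b \<in> S\<rbrakk> \<Longrightarrow> (\<omega> a, \<omega> b) \<in> \<rho>"
    using assms zero_idempotent unfolding group_congruence_iff by blast+
  have "a \<in> cong_ker S m \<rho>"
    if x: "x \<in> cong_ker S m \<rho>" and a: "a \<in> S" and xa: "x \<cdot> a \<in> cong_ker S m \<rho>" for x a
  proof -
    have xS: "x \<in> S"
      using x by (simp add: cong_ker_def)
    have "(x, \<omega> a) \<in> \<rho>"
      using x unfolding cong_ker_iff[OF \<rho>] by (rule congruence_on_trans[OF \<rho> _ E[OF xS a]])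
    then have "(x \<cdot> a, a) \<in> \<rho>"
      using congruence_on_right[OF \<rho>, of x "\<omega> a" a] a by simp
    moreover have "(x \<cdot> a, \<omega> a) \<in> \<rho>"
      using xa unfolding cong_ker_iff[OF \<rho>]
      by (rule congruence_on_trans[OF \<rho> _ E[OF closed[OF xS a] a]])
    ultimately show ?thesis
      unfolding cong_ker_iff[OF \<rho>]
      by (rule congruence_on_trans[OF \<rho> congruence_on_sym[OF \<rho>]])
  qed
  then show ?thesis
    using \<rho> unfolding E_unitary_congruence_iff by blast
qed

lemma E_unitary_congruence_cong_ker:
  assumes "E_unitary_congruence S m \<rho>" and "congruence_on S m \<tau>"
    and "cong_ker S m \<tau> = cong_ker S m \<rho>"
  shows "E_unitary_congruence S m \<tau>"
  using assms(1,2) unfolding E_unitary_congruence_iff assms(3) by blast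

section \<open>Existence of the least group congruence and of the least E-unitary congruence\<close>

lemma group_congruence_Times: "group_congruence S m (S \<times> S)"
  unfolding group_congruence_iff using congruence_on_Times by (simp add: idempotents_def)

lemma sigma_cong_eq: "sigma_cong S m = \<Inter>{\<rho>. group_congruence S m \<rho>}"
  and group_congruence_sigma: "group_congruence S m (sigma_cong S m)"
proof -
  have "congruence_on S m (\<Inter>{\<rho>. group_congruence S m \<rho>})"
    using group_congruence_Times
    by (intro congruence_on_Inter) (auto simp: group_congruence_def)
  moreover have "(e, f) \<in> \<Inter>{\<rho>. group_congruence S m \<rho>}"
    if "e \<in> idempotents S m" "f \<in> idempotents S m" for e f
    using that by (simp add: group_congruence_iff)
  ultimately have least: "group_congruence S m (\<Inter>{\<rho>. group_congruence S m \<rho>})"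
    by (intro iffD2[OF group_congruence_iff] conjI ballI)
  show eq: "sigma_cong S m = \<Inter>{\<rho>. group_congruence S m \<rho>}"
    unfolding sigma_cong_def using least by (rule Least_eq_Inter)
  show "group_congruence S m (sigma_cong S m)"
    using least by (simp add: eq)
qed

text \<open>Unitarity of kernels survives intersection by \<open>cong_ker_Inter\<close>; the
  universal congruence makes the family nonempty.\<close>

lemma pi_cong_eq: "pi_cong S m = \<Inter>{\<rho>. E_unitary_congruence S m \<rho>}"
  and E_unitary_congruence_pi: "E_unitary_congruence S m (pi_cong S m)"
proof -
  let ?\<C> = "{\<rho>. E_unitary_congruence S m \<rho>}"
  have nonempty: "?\<C> \<noteq> {}"
    using group_congruence_imp_E_unitary[OF group_congruence_Times] by blast
  have cong: "congruence_on S m \<rho>" if "\<rho> \<in> ?\<C>" for \<rho>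
    using that by (simp add: E_unitary_congruence_def)
  have ker: "cong_ker S m (\<Inter>?\<C>) = (\<Inter>\<rho>\<in>?\<C>. cong_ker S m \<rho>)"
    by (rule cong_ker_Inter[OF cong nonempty])
  have "congruence_on S m (\<Inter>?\<C>)"
    by (rule congruence_on_Inter[OF cong nonempty])
  moreover have "a \<in> cong_ker S m (\<Inter>?\<C>)"
    if "x \<in> cong_ker S m (\<Inter>?\<C>)" "a \<in> S" "x \<cdot> a \<in> cong_ker S m (\<Inter>?\<C>)" for x a
    using that unfolding ker by (auto simp: E_unitary_congruence_iff)
  ultimately have least: "E_unitary_congruence S m (\<Inter>?\<C>)"
    by (intro iffD2[OF E_unitary_congruence_iff] conjI ballI impI)
  show eq: "pi_cong S m = \<Inter>?\<C>"
    unfolding pi_cong_def using least by (rule Least_eq_Inter)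
  show "E_unitary_congruence S m (pi_cong S m)"
    using least by (simp add: eq)
qed

lemma congruence_on_sigma: "congruence_on S m (sigma_cong S m)"
  using group_congruence_sigma by (simp add: group_congruence_def)

lemma congruence_on_pi: "congruence_on S m (pi_cong S m)"
  using E_unitary_congruence_pi by (simp add: E_unitary_congruence_def)

lemma pi_cong_least: "E_unitary_congruence S m \<rho> \<Longrightarrow> pi_cong S m \<subseteq> \<rho>"
  by (auto simp: pi_cong_eq)

text \<open>Only left contexts are tested, unlike in the usual two-sided notion. For the kernels
  used here, membership of a product is invariant under swapping its factors, which supplies right
  compatibility.\<close>

definition syntactic_congruence :: "'a set \<Rightarrow> 'a rel" where
  "syntactic_congruence K = {(a, b). a \<in> S \<and> b \<in> S \<and> (\<forall>x\<in>S. x \<cdot> a \<in> K \<longleftrightarrow> x \<cdot> b \<in> K)}"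

text \<open>The kernel \<open>K\<close> contains all idempotents and is a unitary subsemigroup, so
  \<open>x \<cdot> e \<in> K\<close> iff \<open>x \<in> K\<close> for each idempotent
  \<open>e\<close>; hence all idempotents are syntactically equivalent. If \<open>a\<close> is
  equivalent to \<open>\<omega> a\<close>, testing with \<open>x = \<omega> a\<close> puts
  \<open>a\<close> into \<open>K\<close>.\<close>

lemma group_congruence_syntactic:
  assumes \<rho>: "E_unitary_congruence S m \<rho>"
  defines "\<tau> \<equiv> syntactic_congruence (cong_ker S m \<rho>)"
  shows "group_congruence S m \<tau>" and "cong_ker S m \<tau> \<subseteq> cong_ker S m \<rho>"
proof -
  define K where "K = cong_ker S m \<rho>"
  have cong: "congruence_on S m \<rho>"
    and unitary: "\<And>x a. \<lbrakk>x \<in> K; a \<in> S; x \<cdot> a \<in> K\<rbrakk> \<Longrightarrow> a \<in> K"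
    using \<rho> unfolding E_unitary_congruence_iff K_def by blast+
  have KS: "x \<in> S" if "x \<in> K" for x
    using that by (simp add: K_def cong_ker_def)
  have zeroK: "\<omega> a \<in> K" if "a \<in> S" for a
    using idempotent_in_cong_ker[OF cong] that by (simp add: K_def)
  have swap: "b \<cdot> a \<in> K" if "a \<cdot> b \<in> K" "a \<in> S" "b \<in> S" for a b
    using that cong_ker_mult_commute[OF cong] by (simp add: K_def)
  have multK: "x \<cdot> y \<in> K" if x: "x \<in> K" and y: "y \<in> K" for x y
  proof -
    define a where "a = x \<cdot> y"
    have aS: "a \<in> S" and S: "x \<in> S" "y \<in> S"
      using KS x y by (auto simp: a_def)
    \<comment> \<open>Unitarity strips \<open>x\<close> and then \<open>y\<close> from this
      idempotent, leaving \<open>\<iota> a \<in> K\<close>; a third use, on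
      \<open>\<iota> a \<cdot> a\<close>, gives \<open>a \<in> K\<close>.\<close>
    have "x \<cdot> (y \<cdot> \<iota> a) = a \<cdot> \<iota> a"
      unfolding a_def using S by (simp del: mult_inv)
    then have "x \<cdot> (y \<cdot> \<iota> a) = \<omega> a"
      using aS by simp
    then have "y \<cdot> \<iota> a \<in> K"
      using unitary[OF x] S aS zeroK by simp
    then have "\<iota> a \<in> K"
      using unitary[OF y] aS by simp
    then have "a \<in> K"
      using unitary[of "\<iota> a" a] aS zeroK by simp
    then show ?thesis
      by (simp add: a_def)
  qed
  have \<tau>: "(a, b) \<in> \<tau> \<longleftrightarrow> a \<in> S \<and> b \<in> S \<and> (\<forall>x\<in>S. x \<cdot> a \<in> K \<longleftrightarrow> x \<cdot> b \<in> K)" for a b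
    by (simp add: \<tau>_def syntactic_congruence_def K_def)
  have cong\<tau>: "congruence_on S m \<tau>"
  proof (rule congruence_onI)
    fix a b c assume ab: "(a, b) \<in> \<tau>" and c: "c \<in> S"
    then have S: "a \<in> S" "b \<in> S" and iff: "\<And>x. x \<in> S \<Longrightarrow> x \<cdot> a \<in> K \<longleftrightarrow> x \<cdot> b \<in> K"
      by (auto simp: \<tau>)
    show "(c \<cdot> a, c \<cdot> b) \<in> \<tau>"
      using S c iff[OF closed[OF _ c]] by (simp add: \<tau>)
    \<comment> \<open>A cyclic shift turns the right factor \<open>c\<close> into part of a left
      context.\<close>
    have "x \<cdot> (d \<cdot> c) \<in> K \<longleftrightarrow> (c \<cdot> x) \<cdot> d \<in> K" if "x \<in> S" "d \<in> S" for x d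
      using swap[of "x \<cdot> d" c] swap[of c "x \<cdot> d"] that c by auto
    then show "(a \<cdot> c, b \<cdot> c) \<in> \<tau>"
      using S c iff[OF closed[OF c]] by (simp add: \<tau>)
  qed (auto simp: \<tau>)
  have "x \<cdot> e \<in> K \<longleftrightarrow> x \<in> K" if "x \<in> S" "e \<in> idempotents S m" for x e
  proof -
    have "e \<in> S" "e \<in> K"
      using that idempotent_in_cong_ker[OF cong] by (auto simp: K_def idempotents_def)
    then show ?thesis
      using multK[of x e] unitary[of e x] swap[of x e] that(1) by blast
  qed
  then show "group_congruence S m \<tau>"
    unfolding group_congruence_iff using cong\<tau> by (auto simp: \<tau> idempotents_def)
  show "cong_ker S m \<tau> \<subseteq> cong_ker S m \<rho>"
  proof
    fix a assume "a \<in> cong_ker S m \<tau>"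
    then have a: "(a, \<omega> a) \<in> \<tau>"
      by (simp add: cong_ker_iff[OF cong\<tau>])
    then have "a \<in> S"
      by (simp add: \<tau>)
    moreover from this have "\<omega> a \<cdot> a \<in> K \<longleftrightarrow> \<omega> a \<cdot> \<omega> a \<in> K"
      using a by (simp only: \<tau> zero_closed)
    ultimately show "a \<in> cong_ker S m \<rho>"
      using zeroK by (simp add: K_def)
  qed
qed

lemma cong_ker_mono: "\<rho> \<subseteq> \<tau> \<Longrightarrow> cong_ker S m \<rho> \<subseteq> cong_ker S m \<tau>"
  unfolding cong_ker_def by blast

text \<open>\<pi> lies in \<sigma> because group congruences are E-unitary; in return \<sigma> lies
  in the syntactic congruence of the kernel of \<pi>, whose kernel is no larger than that of
  \<pi>.\<close>

lemma cong_ker_pi_eq_sigma: "cong_ker S m (pi_cong S m) = cong_ker S m (sigma_cong S m)"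
proof
  show "cong_ker S m (pi_cong S m) \<subseteq> cong_ker S m (sigma_cong S m)"
    by (intro cong_ker_mono pi_cong_least group_congruence_imp_E_unitary group_congruence_sigma)
  let ?\<tau> = "syntactic_congruence (cong_ker S m (pi_cong S m))"
  have "sigma_cong S m \<subseteq> ?\<tau>"
    using group_congruence_syntactic(1)[OF E_unitary_congruence_pi] by (auto simp: sigma_cong_eq)
  then show "cong_ker S m (sigma_cong S m) \<subseteq> cong_ker S m (pi_cong S m)"
    using group_congruence_syntactic(2)[OF E_unitary_congruence_pi] cong_ker_mono by blast
qed

section \<open>The greatest idempotent separating congruence\<close>

text \<open>\<L> is a right and \<R> a left congruence, so only compatibility on the opposite sides
  has to be demanded. The relation \<open>M\<close> so obtained is a congruence, and every
  congruence inside \<H> satisfies its conditions.\<close>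

lemma mu_cong_iff:
  "(a, b) \<in> mu_cong S m \<longleftrightarrow> (a, b) \<in> green_H S m
     \<and> (\<forall>x\<in>S. (x \<cdot> a, x \<cdot> b) \<in> green_L S m) \<and> (\<forall>y\<in>S. (a \<cdot> y, b \<cdot> y) \<in> green_R S m)"
  and congruence_on_mu: "congruence_on S m (mu_cong S m)"
  and mu_cong_subset: "mu_cong S m \<subseteq> green_H S m"
  and mu_cong_greatest:
    "\<lbrakk>congruence_on S m \<rho>; \<rho> \<subseteq> green_H S m\<rbrakk> \<Longrightarrow> \<rho> \<subseteq> mu_cong S m"
proof -
  define M where "M = {(a, b). (a, b) \<in> green_H S m
     \<and> (\<forall>x\<in>S. (x \<cdot> a, x \<cdot> b) \<in> green_L S m) \<and> (\<forall>y\<in>S. (a \<cdot> y, b \<cdot> y) \<in> green_R S m)}"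
  have M: "(a, b) \<in> M \<longleftrightarrow> (a, b) \<in> green_H S m
     \<and> (\<forall>x\<in>S. (x \<cdot> a, x \<cdot> b) \<in> green_L S m) \<and> (\<forall>y\<in>S. (a \<cdot> y, b \<cdot> y) \<in> green_R S m)" for a b
    by (simp add: M_def)
  have MH: "M \<subseteq> green_H S m"
    by (auto simp: M)
  have cong: "congruence_on S m M"
  proof (rule congruence_onI)
    fix a b c assume ab: "(a, b) \<in> M" and c: "c \<in> S"
    have S: "a \<in> S" "b \<in> S" and L: "(a, b) \<in> green_L S m" and R: "(a, b) \<in> green_R S m"
      using ab by (auto simp: M green_H_def green_L_def)
    show "(c \<cdot> a, c \<cdot> b) \<in> M"
      using ab c S green_R_left[OF R c] green_R_left[of "a \<cdot> _" "b \<cdot> _" c]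
      unfolding M green_H_def by (metis IntI assoc closed)
    show "(a \<cdot> c, b \<cdot> c) \<in> M"
      using ab c S green_L_right[OF L c] green_L_right[of "_ \<cdot> a" "_ \<cdot> b" c]
      unfolding M green_H_def by (metis IntI assoc closed)
  qed (auto simp: M green_H_def green_L_def green_R_def)
  have greatest: "\<rho> \<subseteq> M" if \<rho>: "congruence_on S m \<rho>" and H: "\<rho> \<subseteq> green_H S m" for \<rho>
  proof
    fix p assume "p \<in> \<rho>"
    moreover obtain a b where "p = (a, b)"
      by (cases p)
    ultimately show "p \<in> M"
      using H congruence_on_left[OF \<rho>, of a b] congruence_on_right[OF \<rho>, of a b]
      unfolding green_H_def by (auto simp: M green_H_def)
  qed
  have eq: "mu_cong S m = M"
    unfolding mu_cong_def
  proof (rule Greatest_equality)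
    show "congruence_on S m M \<and> idempotent_separating S m M"
      using cong MH idempotent_separating_iff[OF cong] by blast
    show "\<rho> \<subseteq> M" if "congruence_on S m \<rho> \<and> idempotent_separating S m \<rho>" for \<rho>
      using that greatest idempotent_separating_iff by blast
  qed
  show "(a, b) \<in> mu_cong S m \<longleftrightarrow> (a, b) \<in> green_H S m
     \<and> (\<forall>x\<in>S. (x \<cdot> a, x \<cdot> b) \<in> green_L S m) \<and> (\<forall>y\<in>S. (a \<cdot> y, b \<cdot> y) \<in> green_R S m)"
    "congruence_on S m (mu_cong S m)" "mu_cong S m \<subseteq> green_H S m"
    using M MH cong by (simp_all add: eq)
  show "\<lbrakk>congruence_on S m \<rho>; \<rho> \<subseteq> green_H S m\<rbrakk> \<Longrightarrow> \<rho> \<subseteq> mu_cong S m"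
    using greatest by (simp add: eq)
qed

lemma idempotent_separating_iff_mu:
  "congruence_on S m \<rho> \<Longrightarrow> idempotent_separating S m \<rho> \<longleftrightarrow> \<rho> \<subseteq> mu_cong S m"
  using idempotent_separating_iff mu_cong_subset mu_cong_greatest by blast

section \<open>The equivalences\<close>

text \<open>\<open>Id_on S\<close> lies below every congruence, so the intersection of those with
  the trace of \<rho> is \<open>Id_on S\<close> exactly when \<open>Id_on S\<close> is one of
  them.\<close>

lemma idempotent_separating_iff_least_same_tr:
  assumes \<rho>: "congruence_on S m \<rho>"
  shows "idempotent_separating S m \<rho> \<longleftrightarrow> least_same_tr S m \<rho> = Id_on S"
proof -
  let ?P = "\<lambda>\<tau>. congruence_on S m \<tau> \<and> cong_tr S m \<tau> = cong_tr S m \<rho>"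
  have "congruence_on S m (\<Inter>{\<tau>. ?P \<tau>})"
    using \<rho> by (intro congruence_on_Inter) auto
  moreover have "cong_tr S m (\<Inter>{\<tau>. ?P \<tau>}) = cong_tr S m \<rho>"
    using \<rho> unfolding cong_tr_def by blast
  ultimately have least: "?P (\<Inter>{\<tau>. ?P \<tau>})"
    by blast
  have eq: "least_same_tr S m \<rho> = \<Inter>{\<tau>. ?P \<tau>}"
    unfolding least_same_tr_def using least by (rule Least_eq_Inter)
  have "Id_on S \<subseteq> \<Inter>{\<tau>. ?P \<tau>}"
    by (auto intro: congruence_on_refl)
  then have "?P (Id_on S) \<longleftrightarrow> \<Inter>{\<tau>. ?P \<tau>} = Id_on S"
  proof (intro iffI)
    assume "?P (Id_on S)"
    then have "\<Inter>{\<tau>. ?P \<tau>} \<subseteq> Id_on S"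
      by (intro Inter_lower) simp
    then show "\<Inter>{\<tau>. ?P \<tau>} = Id_on S"
      using \<open>Id_on S \<subseteq> _\<close> by (rule subset_antisym)
  next
    assume "\<Inter>{\<tau>. ?P \<tau>} = Id_on S"
    then show "?P (Id_on S)"
      using least by simp
  qed
  then show ?thesis
    using congruence_on_Id_on by (simp add: eq idempotent_separating_iff_tr[OF \<rho>])
qed

text \<open>Inside \<H> the idempotents \<open>\<omega> a\<close> and \<open>\<omega> b\<close>
  agree, and the defining equation collapses to \<open>b = a\<close>. Conversely any two idempotents
  satisfy it, both sides being \<open>e \<cdot> f\<close>.\<close>

lemma idempotent_separating_iff_Theta:
  assumes \<rho>: "congruence_on S m \<rho>"
  shows "idempotent_separating S m \<rho> \<longleftrightarrow>
    \<rho> \<inter> {(a, b). a \<in> S \<and> b \<in> S \<and> \<omega> a \<cdot> b = a \<cdot> \<omega> b} = Id_on S"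
    (is "_ \<longleftrightarrow> \<rho> \<inter> ?\<Theta> = _")
proof
  assume "idempotent_separating S m \<rho>"
  then have H: "\<rho> \<subseteq> green_H S m"
    using idempotent_separating_iff[OF \<rho>] by blast
  show "\<rho> \<inter> ?\<Theta> = Id_on S"
  proof (intro equalityI subrelI)
    fix a b assume "(a, b) \<in> \<rho> \<inter> ?\<Theta>"
    then have ab: "(a, b) \<in> green_H S m" and eq: "\<omega> a \<cdot> b = a \<cdot> \<omega> b"
      using H by auto
    then have S: "a \<in> S" "b \<in> S" and zero_eq: "\<omega> a = \<omega> b"
      by (simp_all add: green_H_iff)
    have "b = \<omega> a \<cdot> b"
      using S zero_eq by simp
    also have "\<dots> = a"
      unfolding eq zero_eq[symmetric] using S by simp
    finally show "(a, b) \<in> Id_on S"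
      using S by (simp add: Id_on_iff)
  next
    show "(a, b) \<in> \<rho> \<inter> ?\<Theta>" if "(a, b) \<in> Id_on S" for a b
      using that congruence_on_refl[OF \<rho>] by (auto simp: Id_on_iff)
  qed
next
  assume \<Theta>: "\<rho> \<inter> ?\<Theta> = Id_on S"
  show "idempotent_separating S m \<rho>"
    unfolding idempotent_separating_def
  proof (intro ballI impI)
    fix e f assume e: "e \<in> idempotents S m" and f: "f \<in> idempotents S m" and ef: "(e, f) \<in> \<rho>"
    have "(e, f) \<in> ?\<Theta>"
      using e f zero_of_idempotent[OF e] zero_of_idempotent[OF f] by (auto simp: idempotents_def)
    then have "(e, f) \<in> Id_on S"
      using ef \<Theta> by blast
    then show "e = f"
      by (simp add: Id_on_iff)
  qed
qed

abbreviation "ker_sigma \<equiv> cong_ker S m (sigma_cong S m)"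

text \<open>Forward, the intersection of \<sigma> and \<mu> inherits the unitary kernel of \<sigma>
  and so contains \<pi>. Backward, \<pi> lies in \<mu> and has the same kernel as \<sigma>.\<close>

lemma cong_ker_sigma_subset_mu_iff:
  "ker_sigma \<subseteq> cong_ker S m (mu_cong S m) \<longleftrightarrow> idempotent_separating S m (pi_cong S m)"
proof
  let ?\<rho> = "sigma_cong S m \<inter> mu_cong S m"
  assume sub: "ker_sigma \<subseteq> cong_ker S m (mu_cong S m)"
  have \<rho>: "congruence_on S m ?\<rho>"
    by (rule congruence_on_Int[OF congruence_on_sigma congruence_on_mu])
  have "cong_ker S m ?\<rho> = ker_sigma"
    using sub cong_ker_iff[OF \<rho>] cong_ker_iff[OF congruence_on_sigma]
      cong_ker_iff[OF congruence_on_mu] by blast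
  then have "E_unitary_congruence S m ?\<rho>"
    using E_unitary_congruence_cong_ker group_congruence_imp_E_unitary group_congruence_sigma \<rho>
    by blast
  then have "pi_cong S m \<subseteq> mu_cong S m"
    using pi_cong_least by blast
  then show "idempotent_separating S m (pi_cong S m)"
    using idempotent_separating_iff_mu[OF congruence_on_pi] by blast
next
  assume "idempotent_separating S m (pi_cong S m)"
  then have "pi_cong S m \<subseteq> mu_cong S m"
    using idempotent_separating_iff_mu[OF congruence_on_pi] by blast
  then show "ker_sigma \<subseteq> cong_ker S m (mu_cong S m)"
    using cong_ker_mono cong_ker_pi_eq_sigma by blast
qed

lemma sigma_Int_green_H_eq:
  assumes sub: "ker_sigma \<subseteq> cong_ker S m (mu_cong S m)"
  shows "sigma_cong S m \<inter> green_H S m = sigma_cong S m \<inter> mu_cong S m"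
proof -
  note \<sigma> = congruence_on_sigma and \<mu> = congruence_on_mu
  have "(a, b) \<in> mu_cong S m" if ab: "(a, b) \<in> sigma_cong S m" and H: "(a, b) \<in> green_H S m" for a b
  proof -
    have S: "a \<in> S" "b \<in> S" and eq: "\<omega> a = \<omega> b"
      using H by (auto simp: green_H_iff)
    \<comment> \<open>The "quotient" of \<open>a\<close> by \<open>b\<close>: it is \<sigma>-related
      to \<open>\<omega> b\<close>, hence \<mu>-related to \<open>\<omega> c = \<omega> b\<close> by
      assumption, and multiplying by \<open>b\<close> recovers \<open>a\<close> and
      \<open>b\<close>.\<close>
    define c where "c = a \<cdot> \<iota> b"
    have cS: "c \<in> S"
      using S by (simp add: c_def)
    have c: "(c, \<omega> b) \<in> sigma_cong S m"
      using congruence_on_right[OF \<sigma> ab, of "\<iota> b"] S by (simp add: c_def)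
    then have "c \<in> ker_sigma"
      using S cS unfolding cong_ker_def by auto
    then have "(c, \<omega> c) \<in> mu_cong S m"
      using sub cong_ker_iff[OF \<mu>] by blast
    moreover have "\<omega> c = \<omega> b"
    proof -
      \<comment> \<open>The inverse of \<open>c\<close> in the \<H>-class of
        \<open>\<omega> b\<close>, which places \<open>c\<close> in that class.\<close>
      define d where "d = b \<cdot> \<iota> a"
      have d: "d \<in> S"
        using S by (simp add: d_def)
      have "c \<cdot> d = \<omega> b" "d \<cdot> c = \<omega> b" "\<omega> b \<cdot> c = c" "c \<cdot> \<omega> b = c"
        using S eq[symmetric] mult_zero[of b] zero_mult[of b] zero_inv[of b] inv_zero[of b]
        by (simp_all add: c_def d_def)
      then have "(c, \<omega> b) \<in> green_H S m"
        unfolding green_H_def Int_iff green_L_iff green_R_iff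
        using cS d S zero_closed[OF S(2)] by metis
      then show ?thesis
        using S by (simp add: green_H_iff)
    qed
    ultimately have "(c \<cdot> b, \<omega> b \<cdot> b) \<in> mu_cong S m"
      using congruence_on_right[OF \<mu> _ S(2)] by simp
    then show ?thesis
      using S eq mult_zero[of a] by (simp add: c_def)
  qed
  then show ?thesis
    using mu_cong_subset by auto
qed

text \<open>Every \<open>a\<close> is \<H>-related to \<open>\<omega> a\<close>, so kernel elements
  of \<sigma> give pairs of the intersection, which lies below \<mu> once it is a
  congruence.\<close>

lemma sigma_Int_green_H_congruence:
  assumes \<rho>: "congruence_on S m (sigma_cong S m \<inter> green_H S m)"
  shows "ker_sigma \<subseteq> cong_ker S m (mu_cong S m)"
proof
  fix a assume "a \<in> ker_sigma"
  then have a: "(a, \<omega> a) \<in> sigma_cong S m"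
    by (simp add: cong_ker_iff[OF congruence_on_sigma])
  then have "(a, \<omega> a) \<in> sigma_cong S m \<inter> green_H S m"
    using congruence_on_dom[OF congruence_on_sigma a] by (simp add: green_H_iff)
  then have "(a, \<omega> a) \<in> mu_cong S m"
    using mu_cong_greatest[OF \<rho>] by blast
  then show "a \<in> cong_ker S m (mu_cong S m)"
    by (simp add: cong_ker_iff[OF congruence_on_mu])
qed

text \<open>Instantiating the locale with the same \<open>\<iota>\<close> makes \<omega> agree in
  \<open>ker_sigma\<close> and in \<open>S\<close>.\<close>

lemma commuting_inverses_cong_ker_sigma: "commuting_inverses ker_sigma m \<iota>"
proof
  note \<sigma> = congruence_on_sigma
  have KS: "a \<in> S" if "a \<in> ker_sigma" for a
    using that by (simp add: cong_ker_def)
  show "ker_sigma \<noteq> {}"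
    using nonempty idempotent_in_cong_ker[OF \<sigma>] zero_idempotent by blast
  show "a \<cdot> b \<in> ker_sigma" if a: "a \<in> ker_sigma" and b: "b \<in> ker_sigma" for a b
  proof -
    have "(a \<cdot> b, \<omega> a \<cdot> \<omega> b) \<in> sigma_cong S m"
      using a b congruence_on_mult[OF \<sigma>] by (simp add: cong_ker_iff[OF \<sigma>])
    \<comment> \<open>A product of idempotents need not be idempotent, but \<sigma> identifies
      \<open>\<omega> b\<close> with \<open>\<omega> a\<close>.\<close>
    moreover have "(\<omega> a \<cdot> \<omega> b, \<omega> a) \<in> sigma_cong S m"
    proof -
      have "(\<omega> b, \<omega> a) \<in> sigma_cong S m"
        using group_congruence_sigma KS[OF a] KS[OF b] by (simp add: group_congruence_iff)
      from congruence_on_left[OF \<sigma> this, of "\<omega> a"] show ?thesis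
        using KS[OF a] by simp
    qed
    ultimately show ?thesis
      using congruence_on_trans[OF \<sigma>] KS[OF a] KS[OF b] closed zero_idempotent
      unfolding cong_ker_def by blast
  qed
  show "\<iota> a \<in> ker_sigma" if "a \<in> ker_sigma" for a
    using inv_in_cong_ker[OF \<sigma> that] .
  show "a \<cdot> b \<cdot> c = a \<cdot> (b \<cdot> c)" if "a \<in> ker_sigma" "b \<in> ker_sigma" "c \<in> ker_sigma" for a b c
    using that[THEN KS] by (rule assoc)
  show "\<iota> a \<cdot> a = a \<cdot> \<iota> a" "a \<cdot> \<iota> a \<cdot> a = a" "\<iota> a \<cdot> a \<cdot> \<iota> a = \<iota> a" if "a \<in> ker_sigma" for a
    using KS[OF that] inv_commute inv_regular inv_reflexive by blast+
qed

lemma cryptic_cong_ker_sigma_iff: "cryptic ker_sigma m \<longleftrightarrow> ker_sigma \<subseteq> cong_ker S m (mu_cong S m)"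
proof
  note \<sigma> = congruence_on_sigma and \<mu> = congruence_on_mu
  note green_H_K_iff = commuting_inverses.green_H_iff[OF commuting_inverses_cong_ker_sigma]
  note closedK = semigroup_on.closed[OF commuting_inverses.axioms(1)[OF commuting_inverses_cong_ker_sigma]]
  have KS: "a \<in> S" if "a \<in> ker_sigma" for a
    using that by (simp add: cong_ker_def)
  {
    assume "cryptic ker_sigma m"
    then have H: "congruence_on ker_sigma m (green_H ker_sigma m)"
      by (simp add: cryptic_def)
    have HS: "(a, b) \<in> green_H S m" if "(a, b) \<in> green_H ker_sigma m" for a b
      using that KS by (auto simp: green_H_iff green_H_K_iff)
    show "ker_sigma \<subseteq> cong_ker S m (mu_cong S m)"
    proof
      fix a assume a: "a \<in> ker_sigma"
      have aS: "a \<in> S"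
        using KS[OF a] .
      have zeroK: "\<omega> x \<in> ker_sigma" if "x \<in> S" for x
        using that idempotent_in_cong_ker[OF \<sigma>] by simp
      have Ha: "(a, \<omega> a) \<in> green_H ker_sigma m"
        using a aS zeroK[OF aS] by (simp add: green_H_K_iff)
      have "(x \<cdot> a, x \<cdot> \<omega> a) \<in> green_L S m" if x: "x \<in> S" for x
      proof -
        \<comment> \<open>\<open>x\<close> need not lie in \<open>ker_sigma\<close>, but
          \<open>\<omega> x\<close> does. Replacing one by the other stays within \<L>, so
          crypticity of \<open>ker_sigma\<close> applies to arbitrary left multipliers.\<close>
        have shift: "(x \<cdot> b, \<omega> x \<cdot> b) \<in> green_L S m" if "b \<in> S" for b
        proof -
          have "x \<cdot> b = x \<cdot> (\<omega> x \<cdot> b)" "\<omega> x \<cdot> b = \<iota> x \<cdot> (x \<cdot> b)"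
            using x that by simp_all
          then show ?thesis
            unfolding green_L_iff using x that by (metis closed inv_closed zero_closed)
        qed
        have "(\<omega> x \<cdot> a, \<omega> x \<cdot> \<omega> a) \<in> green_L S m"
          using HS[OF congruence_on_left[OF H Ha zeroK[OF x]]] by (simp add: green_H_def)
        then show ?thesis
          using shift[OF aS] shift[OF zero_closed[OF aS]] by (simp add: green_L_def)
      qed
      moreover have "(a \<cdot> x, \<omega> a \<cdot> x) \<in> green_R S m" if x: "x \<in> S" for x
      proof -
        have shift: "(b \<cdot> x, b \<cdot> \<omega> x) \<in> green_R S m" if "b \<in> S" for b
        proof -
          have "b \<cdot> x = (b \<cdot> \<omega> x) \<cdot> x" "b \<cdot> \<omega> x = (b \<cdot> x) \<cdot> \<iota> x"
            using x that by simp_all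
          then show ?thesis
            unfolding green_R_iff using x that by (metis closed inv_closed zero_closed)
        qed
        have "(a \<cdot> \<omega> x, \<omega> a \<cdot> \<omega> x) \<in> green_R S m"
          using HS[OF congruence_on_right[OF H Ha zeroK[OF x]]] by (simp add: green_H_def)
        then show ?thesis
          using shift[OF aS] shift[OF zero_closed[OF aS]] by (simp add: green_R_def)
      qed
      ultimately have "(a, \<omega> a) \<in> mu_cong S m"
        using aS by (simp add: mu_cong_iff green_H_iff)
      then show "a \<in> cong_ker S m (mu_cong S m)"
        by (simp add: cong_ker_iff[OF \<mu>])
    qed
  next
    assume sub: "ker_sigma \<subseteq> cong_ker S m (mu_cong S m)"
    have eq: "green_H ker_sigma m = sigma_cong S m \<inter> mu_cong S m \<inter> (ker_sigma \<times> ker_sigma)"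
    proof -
      \<comment> \<open>Both elements are \<sigma>-related to their common idempotent. Hence \<H> of
        \<open>ker_sigma\<close> is the restriction of a relation already known to be a
        congruence.\<close>
      have "(a, b) \<in> sigma_cong S m" if "a \<in> ker_sigma" "b \<in> ker_sigma" "\<omega> a = \<omega> b" for a b
        using that congruence_on_sym[OF \<sigma>] congruence_on_trans[OF \<sigma>]
        by (metis cong_ker_iff[OF \<sigma>])
      then have "green_H ker_sigma m = sigma_cong S m \<inter> green_H S m \<inter> (ker_sigma \<times> ker_sigma)"
        using KS by (auto simp: green_H_iff green_H_K_iff)
      then show ?thesis
        using sigma_Int_green_H_eq[OF sub] by simp
    qed
    have "congruence_on ker_sigma m (sigma_cong S m \<inter> mu_cong S m \<inter> (ker_sigma \<times> ker_sigma))"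
    proof (rule congruence_onI)
      note \<tau> = congruence_on_Int[OF \<sigma> \<mu>]
      let ?\<tau> = "sigma_cong S m \<inter> mu_cong S m \<inter> (ker_sigma \<times> ker_sigma)"
      show "(b, a) \<in> ?\<tau>" if "(a, b) \<in> ?\<tau>" for a b
        using that congruence_on_sym[OF \<tau>] by blast
      show "(a, c) \<in> ?\<tau>" if "(a, b) \<in> ?\<tau>" "(b, c) \<in> ?\<tau>" for a b c
        using that congruence_on_trans[OF \<tau>] by blast
      show "(c \<cdot> a, c \<cdot> b) \<in> ?\<tau>" "(a \<cdot> c, b \<cdot> c) \<in> ?\<tau>" if "(a, b) \<in> ?\<tau>" "c \<in> ker_sigma" for a b c
        using that congruence_on_left[OF \<tau>, of a b c] congruence_on_right[OF \<tau>, of a b c] KS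
          closedK by blast+
    qed (use congruence_on_refl[OF \<sigma>] congruence_on_refl[OF \<mu>] KS in auto)
    then show "cryptic ker_sigma m"
      by (simp add: cryptic_def eq)
  }
qed

end

section \<open>Completely regular semigroups\<close>

context semigroup_on
begin

text \<open>For idempotent \<open>e\<close> this is the group of units of the local monoid
  \<open>eSe\<close>, the largest subgroup with identity \<open>e\<close>.\<close>

definition unit_group :: "'a \<Rightarrow> 'a set" where
  "unit_group e = {b \<in> S. m e b = b \<and> m b e = b \<and>
     (\<exists>c\<in>S. m e c = c \<and> m c e = c \<and> m b c = e \<and> m c b = e)}"

lemma unit_group_group_on:
  assumes e: "e \<in> S" "m e e = e"
  shows "group_on (unit_group e) m"
  unfolding group_on_iff
proof (intro conjI)
  \<comment> \<open>Used in both orders to show that \<open>m d c\<close> is inverse to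
    \<open>m a b\<close>.\<close>
  have mult: "m (m a b) (m d c) = e"
    if "a \<in> S" "b \<in> S" "c \<in> S" "d \<in> S" "m a c = e" "m b d = e" "m a e = a" for a b c d
  proof -
    have "m (m a b) (m d c) = m (m a (m b d)) c"
      using that(1-4) by (simp add: assoc closed)
    then show ?thesis
      using that(5-7) by simp
  qed
  show "\<forall>a\<in>unit_group e. \<forall>b\<in>unit_group e. m a b \<in> unit_group e"
  proof (intro ballI)
    fix a b assume "a \<in> unit_group e" "b \<in> unit_group e"
    then obtain c d where a: "a \<in> S" "m e a = a" "m a e = a"
      and c: "c \<in> S" "m e c = c" "m c e = c" "m a c = e" "m c a = e"
      and b: "b \<in> S" "m e b = b" "m b e = b"
      and d: "d \<in> S" "m e d = d" "m d e = d" "m b d = e" "m d b = e"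
      unfolding unit_group_def by auto
    have "m e (m a b) = m a b" "m (m a b) e = m a b" "m e (m d c) = m d c" "m (m d c) e = m d c"
      using a b c d e assoc[symmetric, of e a b] assoc[of a b e] assoc[symmetric, of e d c]
        assoc[of d c e] by simp_all
    moreover have "m (m a b) (m d c) = e" "m (m d c) (m a b) = e"
      using mult[of a b c d] mult[of d c b a] a b c d by simp_all
    ultimately show "m a b \<in> unit_group e"
      using a b c d closed unfolding unit_group_def by blast
  qed
  show "\<forall>a\<in>unit_group e. \<forall>b\<in>unit_group e. \<forall>c\<in>unit_group e. m (m a b) c = m a (m b c)"
    by (simp add: unit_group_def assoc)
  show "\<exists>f\<in>unit_group e. (\<forall>x\<in>unit_group e. m f x = x \<and> m x f = x)
      \<and> (\<forall>x\<in>unit_group e. \<exists>y\<in>unit_group e. m y x = f \<and> m x y = f)"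
  proof (rule bexI[where x = e], intro conjI ballI)
    fix x assume "x \<in> unit_group e"
    then obtain y where x: "x \<in> S" "m e x = x" "m x e = x"
      and y: "y \<in> S" "m e y = y" "m y e = y" "m x y = e" "m y x = e"
      unfolding unit_group_def by auto
    then show "m e x = x" "m x e = x"
      by simp_all
    have "y \<in> unit_group e"
      unfolding unit_group_def using x y by auto
    then show "\<exists>y\<in>unit_group e. m y x = e \<and> m x y = e"
      using y by blast
  next
    show "e \<in> unit_group e"
      unfolding unit_group_def using e by auto
  qed
qed

text \<open>A subgroup meeting the group of units has identity \<open>e\<close>: with
  \<open>f\<close> its identity, \<open>m e f\<close> equals \<open>e\<close> on writing
  \<open>e = m x a\<close>, and \<open>f\<close> on writing \<open>f = m a y\<close>.\<close>

lemma subgroup_subset_unit_group: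
  assumes G: "subgroup_of S m G" and a: "a \<in> G" "a \<in> unit_group e" and e: "e \<in> S"
  shows "G \<subseteq> unit_group e"
proof -
  have GS: "G \<subseteq> S" and "group_on G m"
    using G by (simp_all add: subgroup_of_def)
  then obtain f where f: "f \<in> G" "\<forall>x\<in>G. m f x = x \<and> m x f = x"
    and inv: "\<forall>x\<in>G. \<exists>y\<in>G. m y x = f \<and> m x y = f"
    unfolding group_on_iff by auto
  obtain x where x: "x \<in> S" "m x a = e" and ea: "m e a = a"
    using a(2) unfolding unit_group_def by auto
  obtain y where y: "y \<in> G" "m a y = f"
    using inv a(1) by auto
  have S: "a \<in> S" "f \<in> S" "y \<in> S"
    using GS a(1) f(1) y(1) by auto
  have "m e f = e"
    using assoc[OF x(1) S(1,2)] f a(1) x(2) by simp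
  moreover have "m e f = f"
    using assoc[OF e S(1,3)] ea y(2) by simp
  ultimately have "f = e"
    by simp
  then show ?thesis
    using f inv GS unfolding unit_group_def by blast
qed

end

context completely_regular_semigroup
begin

text \<open>Every subgroup containing \<open>a\<close> lies in \<open>unit_group e\<close>, so this
  is the unique maximal subgroup that \<open>cr_inverse\<close> selects.\<close>

lemma cr_inverse_eqI:
  assumes e: "e \<in> S" "m e e = e"
    and a: "a \<in> unit_group e" and x: "x \<in> unit_group e" "m a x = e"
  shows "cr_inverse S m a = x"
proof -
  let ?G = "unit_group e"
  have G: "subgroup_of S m ?G"
    using unit_group_group_on[OF e] by (auto simp: subgroup_of_def unit_group_def)
  have "(THE G. maximal_subgroup S m G \<and> a \<in> G) = ?G"
  proof (rule the_equality)
    show "maximal_subgroup S m ?G \<and> a \<in> ?G"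
      unfolding maximal_subgroup_def
      using G a subgroup_subset_unit_group[OF _ _ a e(1)] by blast
    show "H = ?G" if "maximal_subgroup S m H \<and> a \<in> H" for H
      using that G subgroup_subset_unit_group[OF _ _ a e(1), of H]
      unfolding maximal_subgroup_def by blast
  qed
  moreover have "e \<in> ?G" "\<forall>y\<in>?G. m e y = y \<and> m y e = y"
    using e by (auto simp: unit_group_def)
  ultimately show ?thesis
    unfolding cr_inverse_def using inv_monoid_recordI[OF unit_group_group_on[OF e]] a x by simp
qed

text \<open>Any subgroup \<open>G\<close> containing \<open>a\<close> sits inside the group of units
  of its own identity, so the inverse of \<open>a\<close> in \<open>G\<close> is already
  \<open>cr_inverse S m a\<close>, and the equations are group laws.\<close>

lemma commuting_inverses_cr_inverse: "commuting_inverses S m (cr_inverse S m)"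
proof -
  have "cr_inverse S m a \<in> S \<and> m (cr_inverse S m a) a = m a (cr_inverse S m a)
      \<and> m (m a (cr_inverse S m a)) a = a
      \<and> m (m (cr_inverse S m a) a) (cr_inverse S m a) = cr_inverse S m a"
    if a: "a \<in> S" for a
  proof -
    obtain G where G: "subgroup_of S m G" "a \<in> G"
      using union_of_subgroups a by blast
    have GS: "G \<subseteq> S" and "group_on G m"
      using G(1) by (simp_all add: subgroup_of_def)
    then obtain e where e: "e \<in> G" "\<forall>x\<in>G. m e x = x \<and> m x e = x"
      and inv: "\<forall>x\<in>G. \<exists>y\<in>G. m y x = e \<and> m x y = e"
      unfolding group_on_iff by auto
    obtain x where x: "x \<in> G" "m x a = e" "m a x = e"
      using inv G(2) by auto
    have "G \<subseteq> unit_group e"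
      using GS e inv unfolding unit_group_def by blast
    then have "cr_inverse S m a = x"
      using GS G(2) e x by (intro cr_inverse_eqI) auto
    then show ?thesis
      using GS G(2) e x by auto
  qed
  then show ?thesis
    by unfold_locales blast+
qed

end

theorem theorem2p5:
  fixes S :: "'a set" and m :: "'a \<Rightarrow> 'a \<Rightarrow> 'a"
  assumes "completely_regular_semigroup S m"
  defines "\<sigma> \<equiv> sigma_cong S m"
    and "\<pi> \<equiv> pi_cong S m"
    and "\<mu> \<equiv> mu_cong S m"
    and "\<H> \<equiv> green_H S m"
    and "\<Theta> \<equiv> Theta_rel S m"
    and "\<epsilon> \<equiv> Id_on S"
  shows "(cryptic (cong_ker S m \<sigma>) m \<longleftrightarrow> cong_ker S m \<sigma> \<subseteq> cong_ker S m \<mu>)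
    \<and> (cong_ker S m \<sigma> \<subseteq> cong_ker S m \<mu> \<longleftrightarrow> \<sigma> \<inter> \<H> = \<sigma> \<inter> \<mu>)
    \<and> (\<sigma> \<inter> \<H> = \<sigma> \<inter> \<mu> \<longleftrightarrow> congruence_on S m (\<sigma> \<inter> \<H>))
    \<and> (congruence_on S m (\<sigma> \<inter> \<H>) \<longleftrightarrow> \<pi> \<subseteq> \<mu>)
    \<and> (\<pi> \<subseteq> \<mu> \<longleftrightarrow> least_same_tr S m \<pi> = \<epsilon>)
    \<and> (least_same_tr S m \<pi> = \<epsilon> \<longleftrightarrow>
        (\<exists>\<rho>. E_unitary_congruence S m \<rho> \<and> idempotent_separating S m \<rho>))
    \<and> ((\<exists>\<rho>. E_unitary_congruence S m \<rho> \<and> idempotent_separating S m \<rho>) \<longleftrightarrow> \<pi> \<inter> \<Theta> = \<epsilon>)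
    \<and> (\<pi> \<inter> \<Theta> = \<epsilon> \<longleftrightarrow> over_groups S m \<pi>)"
proof -
  interpret completely_regular_semigroup S m
    by fact
  interpret commuting_inverses S m "cr_inverse S m"
    by (rule commuting_inverses_cr_inverse)
  have \<pi>: "congruence_on S m \<pi>"
    unfolding \<pi>_def by (rule congruence_on_pi)
  have \<Theta>: "\<Theta> = {(a, b). a \<in> S \<and> b \<in> S \<and> m (zero a) b = m a (zero b)}"
    by (simp add: \<Theta>_def Theta_rel_def cr_zero_def zero_def)
  \<comment> \<open>Idempotent separation of \<pi> is the hub to which the conditions on \<pi> are
    tied; facts 3, 4 and 5 form a cycle from the kernel inclusion back to itself.\<close>
  have 1: "cryptic (cong_ker S m \<sigma>) m \<longleftrightarrow> cong_ker S m \<sigma> \<subseteq> cong_ker S m \<mu>"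
    unfolding \<sigma>_def \<mu>_def by (rule cryptic_cong_ker_sigma_iff)
  have 2: "cong_ker S m \<sigma> \<subseteq> cong_ker S m \<mu> \<longleftrightarrow> idempotent_separating S m \<pi>"
    unfolding \<sigma>_def \<mu>_def \<pi>_def by (rule cong_ker_sigma_subset_mu_iff)
  have 3: "cong_ker S m \<sigma> \<subseteq> cong_ker S m \<mu> \<Longrightarrow> \<sigma> \<inter> \<H> = \<sigma> \<inter> \<mu>"
    unfolding \<sigma>_def \<mu>_def \<H>_def by (rule sigma_Int_green_H_eq)
  have 4: "\<sigma> \<inter> \<H> = \<sigma> \<inter> \<mu> \<Longrightarrow> congruence_on S m (\<sigma> \<inter> \<H>)"
    unfolding \<sigma>_def \<mu>_def
    using congruence_on_Int[OF congruence_on_sigma congruence_on_mu] by simp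
  have 5: "congruence_on S m (\<sigma> \<inter> \<H>) \<Longrightarrow> cong_ker S m \<sigma> \<subseteq> cong_ker S m \<mu>"
    unfolding \<sigma>_def \<mu>_def \<H>_def by (rule sigma_Int_green_H_congruence)
  have 6: "idempotent_separating S m \<pi> \<longleftrightarrow> \<pi> \<subseteq> \<mu>"
    unfolding \<mu>_def by (rule idempotent_separating_iff_mu[OF \<pi>])
  have 7: "idempotent_separating S m \<pi> \<longleftrightarrow> least_same_tr S m \<pi> = \<epsilon>"
    unfolding \<epsilon>_def by (rule idempotent_separating_iff_least_same_tr[OF \<pi>])
  \<comment> \<open>Idempotent separation passes to smaller congruences, and \<pi> itself is a
    witness.\<close>
  have 8: "idempotent_separating S m \<pi> \<longleftrightarrow>
      (\<exists>\<rho>. E_unitary_congruence S m \<rho> \<and> idempotent_separating S m \<rho>)"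
    using E_unitary_congruence_pi pi_cong_least
    unfolding \<pi>_def idempotent_separating_def by blast
  have 9: "idempotent_separating S m \<pi> \<longleftrightarrow> \<pi> \<inter> \<Theta> = \<epsilon>"
    unfolding \<Theta> \<epsilon>_def by (rule idempotent_separating_iff_Theta[OF \<pi>])
  have 10: "idempotent_separating S m \<pi> \<longleftrightarrow> over_groups S m \<pi>"
    by (rule idempotent_separating_iff_over_groups[OF \<pi>])
  from 1 2 3 4 5 6 7 8 9 10 show ?thesis
    by argo
qed

end
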